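(* Let $k\ge 2$ and $s\ge 1$ be integers, let $\mathbf{h}\in\mathbb{Z}^k$, let $\mathfrak{B}\subseteq\mathbb{R}$ be measurable, and let $X$ be a sufficiently large positive number. Then \[ I_s(\mathfrak{B};X;\mathbf{h})\ll X^{-1}(\log X)^s\, J^*_{s+1,k}(\mathfrak{B};2X)^{s/(s+1)}\, J^*_{s+1,k}(s\mathfrak{B};X)^{1/(s+1)}, \] where the implicit constant depends at most on $k$ and $s$.
   Context: Write $e(z)=e^{2\pi i z}$ and, for $\boldsymbol{\alpha}=(\alpha_1,\ldots,\alpha_k)\in\mathbb{R}^k$ and $Y>0$, $f_k(\boldsymbol{\alpha};Y)=\sum_{0\le x\le Y} e(\alpha_1x+\alpha_2x^2+\ldots+\alpha_kx^k)$. For measurable $\mathfrak{B}\subseteq\mathbb{R}$ and $\mathbf{h}\in\mathbb{Z}^k$ define \[ I_s(\mathfrak{B};X;\mathbf{h})=\int_{\mathfrak{B}}\int_{[0,1)^{k-1}} f_k(\boldsymbol{\alpha};X)^s e(-\boldsymbol{\alpha}\cdot\mathbf{h})\,d\alpha_1\cdots d\alpha_{k-1}\,d\alpha_k, \] where the outer integral is over $\alpha_k\in\mathfrak{B}$ and $\boldsymbol{\alpha}\cdot\mathbf{h}=\alpha_1h_1+\ldots+\alpha_kh_k$; and for $t\in\mathbb{N}$, \[ J^*_{t,k}(\mathfrak{B};Y)=\int_{\mathfrak{B}}\int_{[0,1)^{k-1}}|f_k(\boldsymbol{\alpha};Y)|^t\,d\alpha_1\cdots d\alpha_{k-1}\,d\alpha_k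 \] (outer integral over $\alpha_k\in\mathfrak{B}$). Also $s\mathfrak{B}=\{s\alpha:\alpha\in\mathfrak{B}\}$. *)

theory Defs
  imports "HOL-Analysis.Analysis"
begin

definition e2pi :: "real \<Rightarrow> complex" where
  "e2pi z = exp (2 * of_real pi * \<i> * of_real z)"

(* Vectors in R^k and Z^k are functions on nat of which only the values at 1, ..., k are used. *)

definition weyl_sum :: "nat \<Rightarrow> (nat \<Rightarrow> real) \<Rightarrow> real \<Rightarrow> complex" where
  "weyl_sum k \<alpha> Y = (\<Sum>x | real x \<le> Y. e2pi (\<Sum>j = 1..k. \<alpha> j * real x ^ j))"

definition unit_box :: "nat \<Rightarrow> (nat \<Rightarrow> real) set" where
  "unit_box k = (\<Pi>\<^sub>E j \<in> {1..<k}. {0..<1})"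

(* The inner variable \<alpha> ranges over the coordinates 1, ..., k - 1 and
   \<alpha>(k := b) is the full point of R^k. *)

definition I_int :: "nat \<Rightarrow> nat \<Rightarrow> real set \<Rightarrow> real \<Rightarrow> (nat \<Rightarrow> int) \<Rightarrow> complex" where
  "I_int k s B X h =
     (LINT b:B | lebesgue.
       (LINT \<alpha>:unit_box k | (\<Pi>\<^sub>M j \<in> {1..<k}. lborel).
          weyl_sum k (\<alpha>(k := b)) X ^ s *
          e2pi (- (\<Sum>j = 1..k. (\<alpha>(k := b)) j * real_of_int (h j)))))"

(* Extended-valued, so that for B of infinite measure the mean value is infinite
   rather than the default value 0 of a non-convergent Bochner integral. *)
definition J_star :: "nat \<Rightarrow> nat \<Rightarrow> real set \<Rightarrow> real \<Rightarrow> ennreal" where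
  "J_star t k B Y =
     (\<integral>\<^sup>+ b \<in> B.
       (\<integral>\<^sup>+ \<alpha> \<in> unit_box k. ennreal (cmod (weyl_sum k (\<alpha>(k := b)) Y) ^ t)
          \<partial>(\<Pi>\<^sub>M j \<in> {1..<k}. lborel))
       \<partial>lebesgue)"

(* Intended for positive exponents only. *)
definition ennreal_powr :: "ennreal \<Rightarrow> real \<Rightarrow> ennreal" where
  "ennreal_powr x a = (if x = \<infinity> then \<infinity> else ennreal (enn2real x powr a))"

end

theory Submission
  imports Defs
begin

text \<open>
  Fix \<open>b = \<alpha>\<^sub>k\<close> and write \<open>\<psi>\<^sub>\<alpha>(x) = \<Sum>\<^sub>j \<alpha>\<^sub>j x\<^sup>j\<close>. For every integer \<open>0 \<le> y \<le> X\<close> a unimodular change of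
  variables \<open>\<alpha> \<mapsto> \<beta>\<close> on the torus replaces \<open>\<psi>\<^sub>\<alpha>(x)\<close> by \<open>\<psi>\<^sub>\<beta>(x + y) - \<psi>\<^sub>\<beta>(y)\<close>, so the inner integral of
  \<open>I\<^sub>s\<close> does not change when \<open>f(\<alpha>; X)\<close> becomes a sum over the window \<open>[y, y + X]\<close> inside \<open>[0, 2X]\<close>.
  Discrete Fourier analysis modulo \<open>Q = \<lfloor>2X\<rfloor> + 1\<close> detects the window at the cost of a factor
  \<open>O(log X)\<close> for each of the \<open>s\<close> copies of \<open>f\<close>, and leaves full sums of length \<open>2X\<close> twisted by \<open>e(ax/Q)\<close>.
  After this the variable \<open>y\<close> only occurs in a phase which is a polynomial of degree \<open>k\<close> in \<open>y\<close> with leading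
  coefficient \<open>-s b\<close>; averaging over \<open>y\<close> produces one more exponential sum of length \<open>X\<close>, whose
  coefficients depend on \<open>\<beta>\<close> through a triangular map preserving the measure of the torus. Hoelder's inequality,
  first in \<open>\<beta>\<close> and then in \<open>b\<close>, gives the two mean values.
\<close>

section \<open>Triangular maps of the torus\<close>

lemma nn_integral_translate_lborel:
  fixes f :: "real \<Rightarrow> ennreal"
  assumes "f \<in> borel_measurable borel"
  shows "(\<integral>\<^sup>+x. f x \<partial>lborel) = (\<integral>\<^sup>+x. f (t + x) \<partial>lborel)"
  using nn_integral_real_affine[OF assms, of 1 t] by simp

lemma periodic_add_of_int:
  fixes h :: "real \<Rightarrow> 'a"
  assumes "\<And>x. h (x + 1) = h x"
  shows "h (of_int n + x) = h x"
proof -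
  have nat: "h (of_nat m + x) = h x" for m x
  proof (induction m)
    case (Suc m)
    then show ?case using assms[of "of_nat m + x"] by (simp add: add_ac)
  qed simp
  show ?thesis
  proof (cases "n \<ge> 0")
    case True
    then show ?thesis using nat[of "nat n" x] by simp
  next
    case False
    then show ?thesis using nat[of "nat (-n)" "of_int n + x"] by simp
  qed
qed

text \<open>Once the integer part of \<open>c\<close> is removed, the interval is [d, d+1) with 0
  \<le> d < 1. Its piece beyond 1 slides back by one period onto [0, d) and completes [d,
  1).\<close>

lemma nn_integral_periodic_unit_interval:
  fixes h :: "real \<Rightarrow> ennreal"
  assumes h [measurable]: "h \<in> borel_measurable borel" and per: "\<And>x. h (x + 1) = h x"
  shows "(\<integral>\<^sup>+x. h x * indicator {c..<c+1} x \<partial>lborel) = (\<integral>\<^sup>+x. h x * indicator {0..<1} x \<partial>lborel)"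
proof -
  define d where "d = frac c"
  have d: "0 \<le> d" "d < 1" "c = of_int \<lfloor>c\<rfloor> + d"
    unfolding d_def by (simp_all add: frac_lt_1) (simp add: frac_def)
  have "(\<integral>\<^sup>+x. h x * indicator {c..<c+1} x \<partial>lborel)
      = (\<integral>\<^sup>+x. h (of_int \<lfloor>c\<rfloor> + x) * indicator {c..<c+1} (of_int \<lfloor>c\<rfloor> + x) \<partial>lborel)"
    by (rule nn_integral_translate_lborel) measurable
  also have "\<dots> = (\<integral>\<^sup>+x. h x * indicator {d..<1} x + h x * indicator {1..<d+1} x \<partial>lborel)"
    unfolding periodic_add_of_int[where h = h, OF per]
    using d by (intro nn_integral_cong) (auto simp: indicator_def)
  also have "\<dots> = (\<integral>\<^sup>+x. h x * indicator {d..<1} x \<partial>lborel) + (\<integral>\<^sup>+x. h x * indicator {1..<d+1} x \<partial>lborel)"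
    by (rule nn_integral_add) measurable
  also have "(\<integral>\<^sup>+x. h x * indicator {1..<d+1} x \<partial>lborel) = (\<integral>\<^sup>+x. h (1 + x) * indicator {1..<d+1} (1 + x) \<partial>lborel)"
    by (rule nn_integral_translate_lborel) measurable
  also have "\<dots> = (\<integral>\<^sup>+x. h x * indicator {0..<d} x \<partial>lborel)"
    using per by (intro nn_integral_cong) (auto simp: indicator_def add_ac)
  also have "(\<integral>\<^sup>+x. h x * indicator {d..<1} x \<partial>lborel) + (\<integral>\<^sup>+x. h x * indicator {0..<d} x \<partial>lborel)
      = (\<integral>\<^sup>+x. h x * indicator {d..<1} x + h x * indicator {0..<d} x \<partial>lborel)"
    by (rule nn_integral_add[symmetric]) measurable
  also have "\<dots> = (\<integral>\<^sup>+x. h x * indicator {0..<1} x \<partial>lborel)"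
    using d by (intro nn_integral_cong) (auto simp: indicator_def)
  finally show ?thesis .
qed

text \<open>The map x -> s x + c winds s times around the circle. Substitution turns s times the
  left side into an integral over an interval of length s, which consists of s full periods, and the
  factor s cancels.\<close>

lemma nn_integral_periodic_affine:
  fixes h :: "real \<Rightarrow> ennreal"
  assumes h [measurable]: "h \<in> borel_measurable borel" and per: "\<And>x. h (x + 1) = h x" and "s \<ge> 1"
  shows "(\<integral>\<^sup>+x. h (real s * x + c) * indicator {0..<1} x \<partial>lborel) = (\<integral>\<^sup>+x. h x * indicator {0..<1} x \<partial>lborel)"
proof -
  have pieces: "(\<integral>\<^sup>+x. h x * indicator {c..<c + real n} x \<partial>lborel) = of_nat n * (\<integral>\<^sup>+x. h x * indicator {0..<1} x \<partial>lborel)" for n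
  proof (induction n)
    case (Suc n)
    have "(\<integral>\<^sup>+x. h x * indicator {c..<c + real (Suc n)} x \<partial>lborel)
       = (\<integral>\<^sup>+x. h x * indicator {c..<c + real n} x + h x * indicator {c + real n..<c + real n + 1} x \<partial>lborel)"
      by (intro nn_integral_cong) (auto simp: indicator_def)
    also have "\<dots> = (\<integral>\<^sup>+x. h x * indicator {c..<c + real n} x \<partial>lborel) + (\<integral>\<^sup>+x. h x * indicator {c + real n..<c + real n + 1} x \<partial>lborel)"
      by (rule nn_integral_add) measurable
    finally show ?case
      unfolding Suc nn_integral_periodic_unit_interval[OF h per] by (simp add: algebra_simps)
  qed simp
  have "(\<integral>\<^sup>+x. h x * indicator {c..<c + real s} x \<partial>lborel)
     = ennreal \<bar>real s\<bar> * (\<integral>\<^sup>+x. h (c + real s * x) * indicator {c..<c + real s} (c + real s * x) \<partial>lborel)"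
    using \<open>s \<ge> 1\<close> by (intro nn_integral_real_affine) auto
  also have "(\<integral>\<^sup>+x. h (c + real s * x) * indicator {c..<c + real s} (c + real s * x) \<partial>lborel)
     = (\<integral>\<^sup>+x. h (real s * x + c) * indicator {0..<1} x \<partial>lborel)"
    using \<open>s \<ge> 1\<close> by (intro nn_integral_cong) (auto simp: indicator_def add_ac zero_le_mult_iff)
  finally have "of_nat s * (\<integral>\<^sup>+x. h (real s * x + c) * indicator {0..<1} x \<partial>lborel)
      = of_nat s * (\<integral>\<^sup>+x. h x * indicator {0..<1} x \<partial>lborel)"
    unfolding pieces by (simp add: ennreal_of_nat_eq_real_of_nat)
  then show ?thesis
    using \<open>s \<ge> 1\<close> by (subst (asm) ennreal_mult_cancel_left) auto
qed

interpretation lborel_product: product_sigma_finite "\<lambda>_::nat. lborel :: real measure"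
  by standard

lemma unit_box_measurable [measurable]: "unit_box n \<in> sets (\<Pi>\<^sub>M j \<in> {1..<n}. lborel)"
  unfolding unit_box_def by (rule sets_PiM_I_finite) auto

text \<open>The condition on \<open>x\<close> and \<open>y\<close> concerns only the coordinates in
  \<open>{1..<n}\<close>, so the predicate also forces \<open>g\<close> to ignore all other
  coordinates.\<close>

definition torus_periodic :: "nat \<Rightarrow> ((nat \<Rightarrow> real) \<Rightarrow> 'a) \<Rightarrow> bool" where
  "torus_periodic n g \<longleftrightarrow> (\<forall>x y. (\<forall>j\<in>{1..<n}. x j - y j \<in> \<int>) \<longrightarrow> g x = g y)"

lemma torus_periodicD: "torus_periodic n g \<Longrightarrow> (\<And>j. j \<in> {1..<n} \<Longrightarrow> x j - y j \<in> \<int>) \<Longrightarrow> g x = g y"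
  by (auto simp: torus_periodic_def)

text \<open>Only the entries \<open>m j i\<close> above the diagonal are used; the diagonal entries of the map are all \<open>s\<close>.\<close>

definition triangular_map :: "nat \<Rightarrow> nat \<Rightarrow> (nat \<Rightarrow> nat \<Rightarrow> real) \<Rightarrow> (nat \<Rightarrow> real) \<Rightarrow> (nat \<Rightarrow> real) \<Rightarrow> nat \<Rightarrow> real" where
  "triangular_map n s m d x = (\<lambda>j\<in>{1..<n}. real s * x j + (\<Sum>i\<in>{j<..<n}. m j i * x i) + d j)"

lemma triangular_map_measurable [measurable]:
  "triangular_map n s m d \<in> (\<Pi>\<^sub>M j \<in> {1..<n}. lborel) \<rightarrow>\<^sub>M (\<Pi>\<^sub>M j \<in> {1..<n}. lborel)"
  unfolding triangular_map_def
  by (intro measurable_restrict) (auto intro!: borel_measurable_add borel_measurable_sum borel_measurable_times measurable_component_singleton)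

text \<open>Induction on the dimension. For a fixed last coordinate t the other coordinates undergo
  a triangular map of smaller dimension, covered by the induction hypothesis. Then t itself moves to
  s t plus a constant, which preserves integrals of periodic functions.\<close>

lemma nn_integral_triangular_map:
  fixes g :: "(nat \<Rightarrow> real) \<Rightarrow> ennreal"
  assumes "s \<ge> 1" "g \<in> borel_measurable (\<Pi>\<^sub>M j \<in> {1..<n}. lborel)" "torus_periodic n g"
  shows "(\<integral>\<^sup>+x. g (triangular_map n s m d x) * indicator (unit_box n) x \<partial>(\<Pi>\<^sub>M j \<in> {1..<n}. lborel))
       = (\<integral>\<^sup>+x. g x * indicator (unit_box n) x \<partial>(\<Pi>\<^sub>M j \<in> {1..<n}. lborel))"
  using assms(2-)
proof (induction n arbitrary: g d)
  case 0
  then show ?case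
    by (intro nn_integral_cong arg_cong2[where f = "(*)"]) (auto intro: torus_periodicD)
next
  case (Suc n)
  show ?case
  \<comment> \<open>For n = 0 the index set \<open>{1..<Suc n}\<close> is still empty, and there is
    no coordinate to split off.\<close>
  proof (cases "n = 0")
    case True
    then show ?thesis
      by (intro nn_integral_cong arg_cong2[where f = "(*)"]) (auto intro: torus_periodicD[OF Suc.prems(2)])
  next
    case False
    let ?P = "\<Pi>\<^sub>M j \<in> {1..<n}. (lborel :: real measure)"
    have ins: "{1..<Suc n} = insert n {1..<n}" using False by auto
    have g [measurable]: "g \<in> borel_measurable (Pi\<^sub>M (insert n {1..<n}) (\<lambda>_. lborel))"
      using Suc.prems(1) unfolding ins .
    have T [measurable]: "triangular_map (Suc n) s m d \<in> (\<Pi>\<^sub>M j \<in> insert n {1..<n}. lborel) \<rightarrow>\<^sub>M (\<Pi>\<^sub>M j \<in> insert n {1..<n}. lborel)"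
      using triangular_map_measurable[of "Suc n" s m d] unfolding ins .
    have box [measurable]: "unit_box (Suc n) \<in> sets (\<Pi>\<^sub>M j \<in> insert n {1..<n}. lborel)"
      using unit_box_measurable[of "Suc n"] unfolding ins .
    have upd [measurable]: "(\<lambda>x. x(n := t)) \<in> ?P \<rightarrow>\<^sub>M (\<Pi>\<^sub>M j \<in> insert n {1..<n}. lborel)" for t
      by (rule measurable_fun_upd[where J = "{1..<n}"]) auto
    have ind: "indicator (unit_box (Suc n)) (x(n := t)) = (indicator (unit_box n) x * indicator {0..<1} t :: ennreal)"
      if "x \<in> space ?P" for x t
    proof -
      have "x(n := t) \<in> unit_box (Suc n) \<longleftrightarrow> x \<in> unit_box n \<and> t \<in> {0..<1}"
        using that False unfolding unit_box_def ins space_PiM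
        by (auto simp: PiE_iff extensional_def fun_upd_def split: if_splits)
      then show ?thesis by (auto simp: indicator_def)
    qed
    define h where "h t = (\<integral>\<^sup>+x. g (x(n := t)) * indicator (unit_box n) x \<partial>?P)" for t
    have split: "(\<integral>\<^sup>+x. G x * indicator (unit_box (Suc n)) x \<partial>(\<Pi>\<^sub>M j \<in> {1..<Suc n}. lborel))
       = (\<integral>\<^sup>+t. (\<integral>\<^sup>+x. G (x(n := t)) * indicator (unit_box n) x \<partial>?P) * indicator {0..<1} t \<partial>lborel)"
      if G [measurable]: "G \<in> borel_measurable (Pi\<^sub>M (insert n {1..<n}) (\<lambda>_. lborel))" for G :: "(nat \<Rightarrow> real) \<Rightarrow> ennreal"
      unfolding ins
    proof (subst lborel_product.product_nn_integral_insert_rev)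
      have [measurable]: "(\<lambda>x. G (x(n := t))) \<in> borel_measurable ?P" for t
        by measurable
      show "(\<integral>\<^sup>+ y. \<integral>\<^sup>+ x. G (x(n := y)) * indicator (unit_box (Suc n)) (x(n := y)) \<partial>?P \<partial>lborel) =
        (\<integral>\<^sup>+ t. (\<integral>\<^sup>+ x. G (x(n := t)) * indicator (unit_box n) x \<partial>?P) * indicator {0..<1} t \<partial>lborel)"
        by (intro nn_integral_cong, subst nn_integral_multc[symmetric])
           (auto intro!: nn_integral_cong simp: ind mult_ac simp del: One_nat_def)
    qed (simp_all del: One_nat_def, measurable)
    have h_meas [measurable]: "h \<in> borel_measurable borel"
    proof -
      have [measurable]: "(\<lambda>(t, x). x(n := t)) \<in> lborel \<Otimes>\<^sub>M ?P \<rightarrow>\<^sub>M (\<Pi>\<^sub>M j \<in> insert n {1..<n}. lborel)"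
        unfolding case_prod_beta by (rule measurable_fun_upd[where J = "{1..<n}"]) auto
      have "(\<lambda>(t, x). g (x(n := t)) * indicator (unit_box n) x) \<in> borel_measurable (lborel \<Otimes>\<^sub>M ?P)"
        by measurable
      interpret sigma_finite_measure ?P
        by (rule lborel_product.sigma_finite) simp
      show ?thesis
        using borel_measurable_nn_integral[OF \<open>(\<lambda>(t, x). g (x(n := t)) * indicator (unit_box n) x) \<in> _\<close>]
        unfolding h_def by simp
    qed
    have h_per: "h (t + 1) = h t" for t
      unfolding h_def
      by (intro nn_integral_cong arg_cong2[where f = "(*)"]) (auto intro: torus_periodicD[OF Suc.prems(2)])
    have "(\<integral>\<^sup>+x. g (triangular_map (Suc n) s m d x) * indicator (unit_box (Suc n)) x \<partial>(\<Pi>\<^sub>M j \<in> {1..<Suc n}. lborel))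
        = (\<integral>\<^sup>+t. (\<integral>\<^sup>+x. g (triangular_map (Suc n) s m d (x(n := t))) * indicator (unit_box n) x \<partial>?P) * indicator {0..<1} t \<partial>lborel)"
      by (rule split) measurable
    also have "\<dots> = (\<integral>\<^sup>+t. h (real s * t + d n) * indicator {0..<1} t \<partial>lborel)"
    proof (intro nn_integral_cong arg_cong2[where f = "(*)"] refl)
      fix t :: real
      let ?g = "\<lambda>x. g (x(n := real s * t + d n))"
      \<comment> \<open>With t fixed, the last column of the matrix only translates the lower
        coordinates; absorbing \<open>m j n * t\<close> into the translation is why the induction
        keeps \<open>d\<close> arbitrary.\<close>
      let ?d = "\<lambda>j. m j n * t + d j"
      have "triangular_map (Suc n) s m d (x(n := t)) = (triangular_map n s m ?d x)(n := real s * t + d n)" for x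
      proof
        fix j
        have "{j<..<Suc n} = insert n {j<..<n}" if "j < n" using that by auto
        moreover have "{n<..<Suc n} = {}" by auto
        ultimately show "triangular_map (Suc n) s m d (x(n := t)) j = ((triangular_map n s m ?d x)(n := real s * t + d n)) j"
          using False by (auto simp: triangular_map_def)
      qed
      then have "(\<integral>\<^sup>+x. g (triangular_map (Suc n) s m d (x(n := t))) * indicator (unit_box n) x \<partial>?P)
          = (\<integral>\<^sup>+x. ?g (triangular_map n s m ?d x) * indicator (unit_box n) x \<partial>?P)"
        by simp
      also have "\<dots> = (\<integral>\<^sup>+x. ?g x * indicator (unit_box n) x \<partial>?P)"
      proof (rule Suc.IH)
        show "torus_periodic n ?g"
          unfolding torus_periodic_def by (auto intro!: torus_periodicD[OF Suc.prems(2)])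
      qed measurable
      finally show "(\<integral>\<^sup>+x. g (triangular_map (Suc n) s m d (x(n := t))) * indicator (unit_box n) x \<partial>?P) = h (real s * t + d n)"
        unfolding h_def .
    qed
    also have "\<dots> = (\<integral>\<^sup>+t. h t * indicator {0..<1} t \<partial>lborel)"
      by (rule nn_integral_periodic_affine[OF h_meas h_per \<open>s \<ge> 1\<close>])
    also have "\<dots> = (\<integral>\<^sup>+x. g x * indicator (unit_box (Suc n)) x \<partial>(\<Pi>\<^sub>M j \<in> {1..<Suc n}. lborel))"
      unfolding h_def by (rule split[symmetric]) measurable
    finally show ?thesis .
  qed
qed

text \<open>Followed by the coordinatewise fractional part \<open>F\<close>, the triangular map
  preserves the measure \<open>M\<close> on the box; this is checked on sets by the preceding lemma.
  Periodicity makes \<open>F\<close> invisible to \<open>g\<close>, so the Bochner integral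
  transfers through the push-forward.\<close>

lemma integral_triangular_map:
  fixes g :: "(nat \<Rightarrow> real) \<Rightarrow> complex"
  assumes "s \<ge> 1" and g [measurable]: "g \<in> borel_measurable (\<Pi>\<^sub>M j \<in> {1..<n}. lborel)"
    and per: "torus_periodic n g"
  shows "(LINT x:unit_box n | (\<Pi>\<^sub>M j \<in> {1..<n}. lborel). g (triangular_map n s m d x))
       = (LINT x:unit_box n | (\<Pi>\<^sub>M j \<in> {1..<n}. lborel). g x)"
proof -
  let ?P = "\<Pi>\<^sub>M j \<in> {1..<n}. (lborel :: real measure)"
  define M where "M = density ?P (\<lambda>x. ennreal (indicator (unit_box n) x))"
  define F where "F x = (\<lambda>j\<in>{1..<n}. frac (x j))" for x :: "nat \<Rightarrow> real"
  let ?T = "triangular_map n s m d"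
  have F [measurable]: "F \<in> ?P \<rightarrow>\<^sub>M ?P"
    unfolding F_def frac_def by measurable
  have sets_M [measurable_cong]: "sets M = sets ?P" and space_M: "space M = space ?P"
    by (simp_all add: M_def del: One_nat_def)
  have F_box: "F x = x" if "x \<in> unit_box n" for x
    using that unfolding F_def unit_box_def by (auto simp: fun_eq_iff PiE_iff extensional_def frac_eq)
  have gF: "g (F x) = g x" for x
    by (rule torus_periodicD[OF per]) (auto simp: F_def frac_def)
  have "distr M M (\<lambda>x. F (?T x)) = M"
  proof (rule measure_eqI)
    fix E assume "E \<in> sets (distr M M (\<lambda>x. F (?T x)))"
    then have E [measurable]: "E \<in> sets ?P" by (simp add: sets_M)
    have "emeasure (distr M M (\<lambda>x. F (?T x))) E = emeasure M ((\<lambda>x. F (?T x)) -` E \<inter> space ?P)"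
      by (subst emeasure_distr) (simp_all add: sets_M space_M del: One_nat_def, measurable)
    also have "\<dots> = (\<integral>\<^sup>+x. indicator E (F (?T x)) * indicator (unit_box n) x \<partial>?P)"
      unfolding M_def
      by (subst emeasure_density) (auto intro!: nn_integral_cong simp: indicator_def simp del: One_nat_def)
    also have "\<dots> = (\<integral>\<^sup>+x. indicator E (F x) * indicator (unit_box n) x \<partial>?P)"
    proof (rule nn_integral_triangular_map[OF \<open>s \<ge> 1\<close>])
      have "F x = F y" if "\<forall>j\<in>{1..<n}. x j - y j \<in> \<int>" for x y
      proof
        fix j
        show "F x j = F y j"
        proof (cases "j \<in> {1..<n}")
          case True
          with that have "x j - y j \<in> \<int>" by blast
          then obtain z where "x j - y j = of_int z" by (rule Ints_cases)
          then have "x j = y j + of_int z" by simp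
          then show ?thesis by (simp add: F_def frac_def)
        qed (auto simp: F_def)
      qed
      then show "torus_periodic n (\<lambda>x. indicator E (F x) :: ennreal)"
        unfolding torus_periodic_def by metis
    qed measurable
    also have "\<dots> = (\<integral>\<^sup>+x. indicator (unit_box n) x * indicator E x \<partial>?P)"
      by (intro nn_integral_cong) (auto simp: indicator_def F_box)
    also have "\<dots> = emeasure M E"
      unfolding M_def by (subst emeasure_density) (simp_all add: ennreal_indicator del: One_nat_def)
    finally show "emeasure (distr M M (\<lambda>x. F (?T x))) E = emeasure M E" .
  qed simp
  have "(LINT x:unit_box n|?P. g (?T x)) = integral\<^sup>L M (\<lambda>x. g (?T x))"
    unfolding M_def set_lebesgue_integral_def
    by (rule integral_density[symmetric]) (auto simp del: One_nat_def)
  also have "\<dots> = integral\<^sup>L M (\<lambda>x. g (F (?T x)))"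
    by (simp add: gF)
  also have "\<dots> = integral\<^sup>L (distr M M (\<lambda>x. F (?T x))) g"
    by (rule integral_distr[symmetric]) measurable
  also have "\<dots> = integral\<^sup>L M g"
    by (simp add: \<open>distr M M (\<lambda>x. F (?T x)) = M\<close>)
  also have "\<dots> = (LINT x:unit_box n|?P. g x)"
    unfolding M_def set_lebesgue_integral_def
    by (rule integral_density) (auto simp del: One_nat_def)
  finally show ?thesis .
qed

section \<open>Weyl sums\<close>

lemma e2pi_conv_cis: "e2pi x = cis (2 * pi * x)"
  by (simp add: e2pi_def cis_conv_exp mult_ac)

lemma e2pi_add: "e2pi (x + y) = e2pi x * e2pi y"
  by (simp add: e2pi_conv_cis cis_mult algebra_simps)

lemma e2pi_diff: "e2pi (x - y) = e2pi x * e2pi (- y)"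
  using e2pi_add[of x "- y"] by simp

lemma e2pi_0 [simp]: "e2pi 0 = 1"
  by (simp add: e2pi_conv_cis)

lemma e2pi_power: "e2pi x ^ n = e2pi (real n * x)"
  by (simp add: e2pi_conv_cis Complex.DeMoivre mult_ac)

lemma e2pi_sum: "e2pi (sum f A) = (\<Prod>i\<in>A. e2pi (f i))"
  by (induction A rule: infinite_finite_induct) (auto simp: e2pi_add)

lemma norm_e2pi [simp]: "norm (e2pi x) = 1"
  by (simp add: e2pi_conv_cis)

lemma cnj_e2pi: "cnj (e2pi x) = e2pi (- x)"
  by (simp add: e2pi_conv_cis cis_cnj)

lemma e2pi_Ints: "x \<in> \<int> \<Longrightarrow> e2pi x = 1"
  by (simp add: e2pi_conv_cis cis_multiple_2pi)

lemma e2pi_eq_1_iff: "e2pi x = 1 \<longleftrightarrow> x \<in> \<int>"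
proof
  assume "e2pi x = 1"
  then have "cos (2 * pi * x) = 1"
    by (auto simp: e2pi_conv_cis complex_eq_iff)
  then show "x \<in> \<int>"
    by (auto simp: cos_one_2pi_int)
qed (rule e2pi_Ints)

lemma e2pi_cong_Ints: "x - y \<in> \<int> \<Longrightarrow> e2pi x = e2pi y"
  using e2pi_add[of y "x - y"] e2pi_Ints[of "x - y"] by simp

lemma e2pi_measurable [measurable]: "e2pi \<in> borel_measurable borel"
  unfolding e2pi_def
  by (intro borel_measurable_continuous_onI continuous_intros)

lemma weyl_sum_altdef:
  assumes "Y \<ge> 0"
  shows "weyl_sum k \<alpha> Y = (\<Sum>x\<le>nat \<lfloor>Y\<rfloor>. e2pi (\<Sum>j = 1..k. \<alpha> j * real x ^ j))"
proof -
  have "{x. real x \<le> Y} = {..nat \<lfloor>Y\<rfloor>}"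
    using assms by (auto simp: le_nat_floor) (metis le_nat_iff of_int_of_nat_eq le_floor_iff zero_le_floor)
  then show ?thesis by (simp add: weyl_sum_def)
qed

lemma e2pi_linear_form_periodic:
  fixes k :: nat
  assumes "\<forall>j\<in>{1..<k}. x j - y j \<in> \<int>" "\<And>j. c j \<in> \<int>"
  shows "e2pi (\<Sum>j = 1..k. (x(k := b)) j * c j) = e2pi (\<Sum>j = 1..k. (y(k := b)) j * c j)"
proof (rule e2pi_cong_Ints)
  have "(\<Sum>j = 1..k. (x(k := b)) j * c j) - (\<Sum>j = 1..k. (y(k := b)) j * c j)
      = (\<Sum>j = 1..k. ((x(k := b)) j - (y(k := b)) j) * c j)"
    by (simp add: sum_subtractf algebra_simps)
  also have "\<dots> \<in> \<int>"
    using assms by (intro Ints_sum Ints_mult) auto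
  finally show "(\<Sum>j = 1..k. (x(k := b)) j * c j) - (\<Sum>j = 1..k. (y(k := b)) j * c j) \<in> \<int>" .
qed

lemma weyl_sum_periodic: "torus_periodic k (\<lambda>\<alpha>. weyl_sum k (\<alpha>(k := b)) Y)"
  unfolding torus_periodic_def weyl_sum_def
  by (intro allI impI sum.cong refl e2pi_linear_form_periodic) auto

text \<open>Joint measurability in the leading coefficient and the remaining ones later makes the
  moments measurable functions of b.\<close>

lemma linear_form_measurable_pair:
  fixes k :: nat and c :: "nat \<Rightarrow> real"
  shows "(\<lambda>(b, \<alpha>). (\<Sum>j = 1..k. (\<alpha>(k := b)) j * c j)) \<in> borel_measurable (borel \<Otimes>\<^sub>M (\<Pi>\<^sub>M j \<in> {1..<k}. lborel))"
proof -
  have "(\<lambda>(b, \<alpha>). (\<alpha>(k := b)) j * c j) \<in> borel_measurable (borel \<Otimes>\<^sub>M (\<Pi>\<^sub>M j \<in> {1..<k}. lborel))"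
    if "j \<in> {1..k}" for j
  proof (cases "j = k")
    case False
    then have "j \<in> {1..<k}" using that by auto
    then have comp: "(\<lambda>\<alpha>. \<alpha> j) \<in> borel_measurable (\<Pi>\<^sub>M j \<in> {1..<k}. lborel)"
      using measurable_component_singleton[of j "{1..<k}" "\<lambda>_. lborel :: real measure"] by simp
    show ?thesis
      unfolding case_prod_beta fun_upd_other[OF False]
      by (intro borel_measurable_times borel_measurable_const measurable_compose[OF measurable_snd comp])
  qed simp
  then show ?thesis
    unfolding case_prod_beta by (intro borel_measurable_sum)
qed

lemma weyl_sum_measurable_pair [measurable]:
  "(\<lambda>(b, \<alpha>). weyl_sum k (\<alpha>(k := b)) Y) \<in> borel_measurable (borel \<Otimes>\<^sub>M (\<Pi>\<^sub>M j \<in> {1..<k}. lborel))"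
  unfolding weyl_sum_def case_prod_beta
  by (intro borel_measurable_sum measurable_compose[OF _ e2pi_measurable]
        linear_form_measurable_pair[unfolded case_prod_beta])

lemma weyl_sum_measurable [measurable]:
  "(\<lambda>\<alpha>. weyl_sum k (\<alpha>(k := b)) Y) \<in> borel_measurable (\<Pi>\<^sub>M j \<in> {1..<k}. lborel)"
  using measurable_compose[OF measurable_Pair1' weyl_sum_measurable_pair, of b] by simp

lemma linear_form_measurable [measurable]:
  fixes k :: nat and c :: "nat \<Rightarrow> real"
  shows "(\<lambda>\<alpha>. (\<Sum>j = 1..k. (\<alpha>(k := b)) j * c j)) \<in> borel_measurable (\<Pi>\<^sub>M j \<in> {1..<k}. lborel)"
  using measurable_compose[OF measurable_Pair1' linear_form_measurable_pair, of b] by simp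

section \<open>Hoelder's inequality\<close>

lemma ennreal_powr_neq_0: "a > 0 \<Longrightarrow> x \<noteq> 0 \<Longrightarrow> ennreal_powr x a \<noteq> 0"
  by (auto simp: ennreal_powr_def enn2real_eq_0_iff ennreal_eq_0_iff)

lemma power_Suc_powr: 
  fixes x :: real
  shows "0 \<le> x \<Longrightarrow> (x ^ Suc n) powr (1 / (real n + 1)) = x"
  by (cases "x = 0") (auto simp: powr_powr add_ac simp flip: powr_realpow simp del: power_Suc)

text \<open>Weighted arithmetic-geometric mean inequality for \<open>a ^ Suc s\<close> and
  \<open>b ^ Suc s\<close> with weights s/(s+1) and 1/(s+1). Zero is treated apart because
  converting real exponents to natural ones uses positive bases.\<close>

lemma Young_power:
  fixes a b :: real
  assumes "a \<ge> 0" "b \<ge> 0"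
  shows "a ^ s * b \<le> real s / (real s + 1) * a ^ Suc s + 1 / (real s + 1) * b ^ Suc s"
proof (cases "a = 0 \<or> b = 0")
  case True
  then show ?thesis using assms by (cases s) auto
next
  case False
  then have pos: "a > 0" "b > 0" using assms by auto
  have "(a ^ Suc s) powr (real s / (real s + 1)) * (b ^ Suc s) powr (1 / (real s + 1))
     \<le> real s / (real s + 1) * a ^ Suc s + 1 / (real s + 1) * b ^ Suc s"
    using pos by (intro Youngs_inequality_0) (auto simp: field_simps simp del: power_Suc)
  moreover have "(a ^ Suc s) powr (real s / (real s + 1)) = a ^ s"
    using power_Suc_powr[of a s] pos
    by (metis less_eq_real_def powr_powr powr_realpow times_divide_eq_left mult_1)
  ultimately show ?thesis
    using power_Suc_powr[of b s] pos by simp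
qed

text \<open>Degenerate moments come first: a zero moment makes the integrand vanish almost
  everywhere, and if none is zero an infinite one makes the right side infinite. Otherwise
  \<open>f\<close> and \<open>g\<close> are divided by their norms \<open>A\<close> and
  \<open>D\<close> in L^(s+1) and Young's inequality is integrated; the weights then add up to
  1.\<close>

lemma nn_integral_Holder_power:
  fixes f g :: "'a \<Rightarrow> real"
  assumes [measurable]: "f \<in> borel_measurable M" "g \<in> borel_measurable M"
    and nonneg: "\<And>x. f x \<ge> 0" "\<And>x. g x \<ge> 0" and "s \<ge> 1"
  shows "(\<integral>\<^sup>+x. ennreal (f x ^ s * g x) \<partial>M)
    \<le> ennreal_powr (\<integral>\<^sup>+x. ennreal (f x ^ Suc s) \<partial>M) (real s / (real s + 1))
      * ennreal_powr (\<integral>\<^sup>+x. ennreal (g x ^ Suc s) \<partial>M) (1 / (real s + 1))"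
    (is "?I \<le> ennreal_powr ?F _ * ennreal_powr ?G _")
proof -
  consider "?F = 0" | "?G = 0" | "?F \<noteq> 0" "?G \<noteq> 0" "?F = \<infinity> \<or> ?G = \<infinity>"
    | "?F \<noteq> 0" "?G \<noteq> 0" "?F \<noteq> \<infinity>" "?G \<noteq> \<infinity>" by blast
  then show ?thesis
  proof cases
    case 1
    then have "AE x in M. ennreal (f x ^ Suc s) = 0"
      by (subst (asm) nn_integral_0_iff_AE) auto
    then have "AE x in M. ennreal (f x ^ s * g x) = 0"
    proof eventually_elim
      case (elim x)
      then have "f x = 0"
        using nonneg by (metis ennreal_eq_0_iff zero_le_power order_antisym power_eq_0_iff)
      then show ?case using \<open>s \<ge> 1\<close> by (simp add: power_0_left)
    qed
    then have "?I = 0"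
      by (subst nn_integral_0_iff_AE) auto
    then show ?thesis by simp
  next
    case 2
    then have "AE x in M. ennreal (g x ^ Suc s) = 0"
      by (subst (asm) nn_integral_0_iff_AE) auto
    then have "AE x in M. ennreal (f x ^ s * g x) = 0"
    proof eventually_elim
      case (elim x)
      then have "g x = 0"
        using nonneg by (metis ennreal_eq_0_iff zero_le_power order_antisym power_eq_0_iff)
      then show ?case using \<open>s \<ge> 1\<close> by (simp add: power_0_left)
    qed
    then have "?I = 0"
      by (subst nn_integral_0_iff_AE) auto
    then show ?thesis by simp
  next
    case 3
    \<comment> \<open>In \<open>ennreal\<close> zero times \<infinity> is zero, so both factors have
      to be nonzero before an infinite one makes the product infinite.\<close>
    have "ennreal_powr ?F (real s / (real s + 1)) \<noteq> 0" "ennreal_powr ?G (1 / (real s + 1)) \<noteq> 0"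
      using 3 \<open>s \<ge> 1\<close> by (intro ennreal_powr_neq_0; simp)+
    moreover have "ennreal_powr ?F (real s / (real s + 1)) = \<infinity> \<or> ennreal_powr ?G (1 / (real s + 1)) = \<infinity>"
      using 3(3) by (auto simp: ennreal_powr_def)
    ultimately have "ennreal_powr ?F (real s / (real s + 1)) * ennreal_powr ?G (1 / (real s + 1)) = \<infinity>"
      by (auto simp: ennreal_mult_eq_top_iff)
    then show ?thesis by simp
  next
    case 4
    define A where "A = enn2real ?F powr (1 / (real s + 1))"
    define D where "D = enn2real ?G powr (1 / (real s + 1))"
    have pos: "enn2real ?F > 0" "enn2real ?G > 0"
      using 4 by (auto simp: enn2real_positive_iff top.not_eq_extremum zero_less_iff_neq_zero)
    then have "A > 0" "D > 0" by (auto simp: A_def D_def)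
    have "A ^ Suc s = enn2real ?F" "D ^ Suc s = enn2real ?G"
      unfolding A_def D_def using pos
      by (simp_all add: powr_powr add_ac flip: powr_realpow del: power_Suc)
    then have AF: "ennreal (A ^ Suc s) = ?F" and DG: "ennreal (D ^ Suc s) = ?G"
      using 4(3,4) by (simp_all only: ennreal_enn2real_if infinity_ennreal_def if_False)
    have As: "enn2real ?F powr (real s / (real s + 1)) = A ^ s"
      using pos by (simp add: A_def powr_powr flip: powr_realpow)
    let ?c = "real s / (real s + 1)" and ?d = "1 / (real s + 1)"
    have comb: "ennreal p * (ennreal q * ennreal u + ennreal r * ennreal v) = ennreal (p * (q * u + r * v))"
      if "p \<ge> 0" "q \<ge> 0" "r \<ge> 0" "u \<ge> 0" "v \<ge> 0" for p q r u v :: real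
      using that by (simp add: ennreal_mult ennreal_plus)
    have "?I \<le> (\<integral>\<^sup>+x. ennreal (A ^ s * D) * (ennreal (?c / A ^ Suc s) * ennreal (f x ^ Suc s)
          + ennreal (?d / D ^ Suc s) * ennreal (g x ^ Suc s)) \<partial>M)"
    proof (intro nn_integral_mono)
      fix x
      have "(f x / A) ^ s * (g x / D) \<le> ?c * (f x / A) ^ Suc s + ?d * (g x / D) ^ Suc s"
        using nonneg \<open>A > 0\<close> \<open>D > 0\<close> by (intro Young_power) auto
      then have "(A ^ s * D) * ((f x / A) ^ s * (g x / D)) \<le> (A ^ s * D) * (?c * (f x / A) ^ Suc s + ?d * (g x / D) ^ Suc s)"
        using \<open>A > 0\<close> \<open>D > 0\<close> by (intro mult_left_mono) auto
      moreover have "(A ^ s * D) * ((f x / A) ^ s * (g x / D)) = f x ^ s * g x"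
        using \<open>A > 0\<close> \<open>D > 0\<close> by (simp add: power_divide)
      moreover have "ennreal (A ^ s * D) * (ennreal (?c / A ^ Suc s) * ennreal (f x ^ Suc s)
          + ennreal (?d / D ^ Suc s) * ennreal (g x ^ Suc s))
        = ennreal (A ^ s * D * (?c / A ^ Suc s * f x ^ Suc s + ?d / D ^ Suc s * g x ^ Suc s))"
        using nonneg \<open>A > 0\<close> \<open>D > 0\<close> by (intro comb) auto
      moreover have "?c * (f x / A) ^ Suc s + ?d * (g x / D) ^ Suc s = ?c / A ^ Suc s * f x ^ Suc s + ?d / D ^ Suc s * g x ^ Suc s"
        by (simp add: power_divide del: power_Suc)
      ultimately show "ennreal (f x ^ s * g x) \<le> ennreal (A ^ s * D) * (ennreal (?c / A ^ Suc s) * ennreal (f x ^ Suc s)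
          + ennreal (?d / D ^ Suc s) * ennreal (g x ^ Suc s))"
        by (simp only: ennreal_leI)
    qed
    also have "\<dots> = ennreal (A ^ s * D) * (ennreal (?c / A ^ Suc s) * ?F + ennreal (?d / D ^ Suc s) * ?G)"
      by (simp add: nn_integral_cmult nn_integral_add del: power_Suc)
    also have "\<dots> = ennreal (A ^ s * D) * (ennreal ?c + ennreal ?d)"
      using \<open>A > 0\<close> \<open>D > 0\<close> by (simp flip: AF DG ennreal_mult'' del: power_Suc)
    also have "\<dots> = ennreal (A ^ s * D)"
      by (simp add: field_simps flip: ennreal_plus)
    also have "\<dots> = ennreal_powr ?F ?c * ennreal_powr ?G ?d"
      using 4 \<open>A > 0\<close> \<open>D > 0\<close> by (simp add: ennreal_powr_def As D_def ennreal_mult' del: power_Suc)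
    finally show ?thesis .
  qed
qed

text \<open>The geometric mean of the powers \<open>x i ^ card I\<close> is the product of the
  \<open>x i\<close> itself, so this is the arithmetic-geometric mean inequality.\<close>

lemma prod_le_mean_power:
  fixes x :: "'a \<Rightarrow> real"
  assumes "finite I" "I \<noteq> {}" "\<And>i. i \<in> I \<Longrightarrow> x i \<ge> 0"
  shows "(\<Prod>i\<in>I. x i) \<le> (\<Sum>i\<in>I. x i ^ card I) / card I"
proof -
  have "card I > 0" using assms by (simp add: card_gt_0_iff)
  moreover have "(\<Prod>i\<in>I. x i) \<ge> 0" using assms by (simp add: prod_nonneg)
  ultimately have "((\<Prod>i\<in>I. x i) ^ card I) powr (1 / card I) = (\<Prod>i\<in>I. x i)"
    using power_Suc_powr[of "\<Prod>i\<in>I. x i" "card I - 1"] by (simp add: of_nat_diff)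
  then show ?thesis
    using arith_geom_mean[of I "\<lambda>i. x i ^ card I"] assms
    by (simp add: prod_power_distrib sum_divide_distrib)
qed

section \<open>Detecting a window by additive characters\<close>

text \<open>If Q does not divide d, the sum is geometric and its ratio is a Q-th root of unity other
  than 1.\<close>

lemma sum_e2pi_multiples:
  fixes d :: int
  assumes "Q > 0"
  shows "(\<Sum>a<Q. e2pi (real a * of_int d / real Q)) = (if int Q dvd d then of_nat Q else 0)"
proof (cases "int Q dvd d")
  case True
  then obtain m where "d = int Q * m" by blast
  then have "e2pi (real a * of_int d / real Q) = 1" for a
    using assms by (intro e2pi_Ints) simp
  then show ?thesis using True by simp
next
  case False
  define r where "r = e2pi (of_int d / real Q)"
  have "r \<noteq> 1"
  proof
    assume "r = 1"
    then obtain m where "of_int d / real Q = of_int m"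
      unfolding r_def e2pi_eq_1_iff by (rule Ints_cases)
    then have "real_of_int d = of_int (int Q * m)"
      using assms by (simp add: field_simps)
    then have "d = int Q * m" by linarith
    then show False using False by simp
  qed
  have "r ^ Q = 1"
    using assms by (simp add: r_def e2pi_power e2pi_Ints)
  have "(\<Sum>a<Q. e2pi (real a * of_int d / real Q)) = (\<Sum>a<Q. r ^ a)"
    by (simp add: r_def e2pi_power)
  also have "\<dots> = 0"
    using \<open>r \<noteq> 1\<close> \<open>r ^ Q = 1\<close> by (simp add: sum_gp_strict)
  finally show ?thesis using False by simp
qed

text \<open>The normalised discrete Fourier coefficient modulo \<open>Q\<close>, at frequency
  \<open>a\<close>, of the indicator function of \<open>{..N}\<close>.\<close>

definition window_coeff :: "nat \<Rightarrow> nat \<Rightarrow> nat \<Rightarrow> complex" where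
  "window_coeff Q N a = (\<Sum>w\<le>N. e2pi (- (real a * real w / real Q))) / of_nat Q"

text \<open>Fourier inversion modulo Q. Both z and w + y lie in [0, Q), because y + N < Q, so a
  congruence between them modulo Q is an equality and the window does not wrap around.\<close>

lemma sum_shifted_window:
  fixes g :: "nat \<Rightarrow> complex"
  assumes "y + N < Q"
  shows "(\<Sum>x\<le>N. g (x + y))
    = (\<Sum>a<Q. window_coeff Q N a * e2pi (- (real a * real y / real Q))
        * (\<Sum>z<Q. g z * e2pi (real a * real z / real Q)))"
proof -
  have orth: "(\<Sum>a<Q. e2pi (- (real a * real w / real Q)) * e2pi (- (real a * real y / real Q)) * e2pi (real a * real z / real Q))
      = (if z = w + y then of_nat Q else 0)" if "w \<le> N" "z < Q" for w z
  proof -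
    have "int Q dvd (int z - int w - int y) \<longleftrightarrow> z = w + y"
    proof
      assume dvd: "int Q dvd (int z - int w - int y)"
      have "\<bar>int z - int w - int y\<bar> < int Q" using that assms by linarith
      with dvd have "int z - int w - int y = 0"
        using dvd_imp_le_int[of "int z - int w - int y" "int Q"] by fastforce
      then show "z = w + y" by linarith
    qed simp
    moreover have "e2pi (- (real a * real w / real Q)) * e2pi (- (real a * real y / real Q)) * e2pi (real a * real z / real Q)
        = e2pi (real a * of_int (int z - int w - int y) / real Q)" for a
      unfolding e2pi_add[symmetric] by (rule arg_cong[where f = e2pi]) (simp add: algebra_simps add_divide_distrib diff_divide_distrib)
    ultimately show ?thesis
      using sum_e2pi_multiples[of Q "int z - int w - int y"] assms by simp
  qed
  define t where "t a w z = e2pi (- (real a * real w / real Q)) * e2pi (- (real a * real y / real Q))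
           * e2pi (real a * real z / real Q)" for a w z
  have "(\<Sum>a<Q. window_coeff Q N a * e2pi (- (real a * real y / real Q))
        * (\<Sum>z<Q. g z * e2pi (real a * real z / real Q)))
      = (\<Sum>a<Q. \<Sum>w\<le>N. \<Sum>z<Q. g z / of_nat Q * t a w z)"
  proof (rule sum.cong[OF refl])
    fix a
    define S where "S = (\<Sum>w\<le>N. e2pi (- (real a * real w / real Q)))"
    have "window_coeff Q N a * e2pi (- (real a * real y / real Q)) * (\<Sum>z<Q. g z * e2pi (real a * real z / real Q))
      = (\<Sum>w\<le>N. e2pi (- (real a * real w / real Q)))
        * (\<Sum>z<Q. g z / of_nat Q * (e2pi (- (real a * real y / real Q)) * e2pi (real a * real z / real Q)))"
      unfolding window_coeff_def S_def[symmetric] by (simp add: sum_distrib_left mult_ac)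
    then show "window_coeff Q N a * e2pi (- (real a * real y / real Q)) * (\<Sum>z<Q. g z * e2pi (real a * real z / real Q))
      = (\<Sum>w\<le>N. \<Sum>z<Q. g z / of_nat Q * t a w z)"
      by (simp add: sum_product t_def mult_ac)
  qed
  also have "\<dots> = (\<Sum>w\<le>N. \<Sum>a<Q. \<Sum>z<Q. g z / of_nat Q * t a w z)"
    by (rule sum.swap)
  also have "\<dots> = (\<Sum>w\<le>N. \<Sum>z<Q. g z / of_nat Q * (\<Sum>a<Q. t a w z))"
    unfolding sum_distrib_left by (rule sum.cong[OF refl]) (rule sum.swap)
  also have "\<dots> = (\<Sum>w\<le>N. \<Sum>z<Q. g z / of_nat Q * (if z = w + y then of_nat Q else 0))"
    unfolding t_def by (intro sum.cong refl arg_cong2[where f = "(*)"] orth) auto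
  also have "\<dots> = (\<Sum>w\<le>N. g (w + y))"
  proof (intro sum.cong refl)
    fix w assume "w \<in> {..N}"
    have "(\<Sum>z<Q. g z / of_nat Q * (if z = w + y then of_nat Q else 0)) = (\<Sum>z<Q. if z = w + y then g z else 0)"
      using assms by (intro sum.cong) auto
    also have "\<dots> = g (w + y)"
      using assms \<open>w \<in> {..N}\<close> by (simp add: sum.delta)
    finally show "(\<Sum>z<Q. g z / of_nat Q * (if z = w + y then of_nat Q else 0)) = g (w + y)" .
  qed
  finally show ?thesis by simp
qed

text \<open>On [0, pi/2] the concave function sin lies above its chord.\<close>

lemma sin_ge_chord:
  assumes "0 \<le> t" "t \<le> 1 / 2"
  shows "sin (pi * t) \<ge> 2 * t"
proof -
  have "concave_on {0..pi} sin"
    by (rule f''_le0_imp_concave[where f' = cos and f'' = "\<lambda>x. - sin x"])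
       (auto intro!: derivative_eq_intros sin_ge_zero)
  then show ?thesis
    using concave_onD[of "{0..pi}" sin "2 * t" 0 "pi / 2"] assms by (simp add: mult_ac)
qed

lemma norm_1_minus_e2pi: "norm (1 - e2pi t) = 2 * \<bar>sin (pi * t)\<bar>"
proof -
  have "(norm (1 - e2pi t))\<^sup>2 = 2 - 2 * cos (2 * (pi * t))"
    using sin_cos_squared_add[of "2 * (pi * t)"]
    by (simp add: cmod_power2 e2pi_conv_cis power2_diff mult_ac)
  also have "\<dots> = (2 * \<bar>sin (pi * t)\<bar>)\<^sup>2"
    by (simp add: cos_double_sin power_mult_distrib)
  finally show ?thesis
    by (metis abs_ge_zero mult_nonneg_nonneg norm_ge_zero power2_eq_imp_eq zero_le_numeral)
qed

text \<open>If u is the distance from t to the nearest integer, then |1 - e(t)| = 2 sin(pi u) \<ge>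
  4u. Bounding 1/u by 1/t + 1/(1-t) gives a symmetric form that can be summed without distinguishing
  the two halves of the interval.\<close>

lemma norm_1_minus_e2pi_ge:
  assumes "0 < t" "t < 1"
  shows "2 / norm (1 - e2pi t) \<le> (1 / t + 1 / (1 - t)) / 2" "e2pi t \<noteq> 1"
proof -
  have *: "2 / norm (1 - e2pi t) \<le> 1 / (2 * u)" "e2pi t \<noteq> 1"
    if "\<bar>sin (pi * t)\<bar> = sin (pi * u)" "0 < u" "u \<le> 1 / 2" for u
  proof -
    have "4 * u \<le> norm (1 - e2pi t)"
      using sin_ge_chord[of u] that by (simp add: norm_1_minus_e2pi)
    then show "2 / norm (1 - e2pi t) \<le> 1 / (2 * u)" "e2pi t \<noteq> 1"
      using that frac_le[of 2 2 "4 * u" "norm (1 - e2pi t)"] by auto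
  qed
  have "2 / norm (1 - e2pi t) \<le> (1 / t + 1 / (1 - t)) / 2 \<and> e2pi t \<noteq> 1"
  proof (cases "t \<le> 1 / 2")
    case True
    have "sin (pi * t) \<ge> 0" using assms by (intro sin_ge_zero) auto
    then have "2 / norm (1 - e2pi t) \<le> 1 / (2 * t)" "e2pi t \<noteq> 1" using *[of t] assms True by auto
    moreover have "1 / (2 * t) \<le> (1 / t + 1 / (1 - t)) / 2"
      using assms by (simp only: add_divide_distrib divide_divide_eq_left mult.commute) simp
    ultimately show ?thesis by (blast intro: order_trans)
  next
    case False
    have "sin (pi * t) \<ge> 0" using assms by (intro sin_ge_zero) auto
    moreover have "sin (pi * t) = sin (pi * (1 - t))"
      by (simp add: right_diff_distrib)
    ultimately have "2 / norm (1 - e2pi t) \<le> 1 / (2 * (1 - t))" "e2pi t \<noteq> 1" using *[of "1 - t"] assms False by auto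
    moreover have "1 / (2 * (1 - t)) \<le> (1 / t + 1 / (1 - t)) / 2"
      using assms by (simp only: add_divide_distrib divide_divide_eq_left mult.commute) simp
    ultimately show ?thesis by (blast intro: order_trans)
  qed
  then show "2 / norm (1 - e2pi t) \<le> (1 / t + 1 / (1 - t)) / 2" "e2pi t \<noteq> 1" by auto
qed

text \<open>The coefficient is a geometric sum with ratio the conjugate of e(a/Q), whose numerator
  has norm at most 2. Writing t = a/Q produces a factor Q that cancels the normalisation.\<close>

lemma norm_window_coeff_le:
  assumes "0 < a" "a < Q"
  shows "norm (window_coeff Q N a) \<le> (1 / real a + 1 / real (Q - a)) / 2"
proof -
  define t where "t = real a / real Q"
  have t: "0 < t" "t < 1" using assms by (auto simp: t_def)
  define r where "r = cnj (e2pi t)"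
  have "norm (1 - r) = norm (1 - e2pi t)"
    unfolding r_def by (metis complex_cnj_diff complex_cnj_one complex_mod_cnj)
  moreover have "r \<noteq> 1"
    using norm_1_minus_e2pi_ge(2)[OF t] unfolding r_def by (metis complex_cnj_cnj complex_cnj_one)
  moreover have "norm (1 - r ^ Suc N) \<le> 2"
    using norm_triangle_ineq4[of 1 "r ^ Suc N"] by (simp add: r_def norm_mult norm_power)
  moreover have "(\<Sum>w\<le>N. e2pi (- (real a * real w / real Q))) = (\<Sum>w\<le>N. r ^ w)"
    by (simp add: r_def cnj_e2pi e2pi_power t_def mult_ac)
  ultimately have "norm (\<Sum>w\<le>N. e2pi (- (real a * real w / real Q))) \<le> 2 / norm (1 - e2pi t)"
    using norm_1_minus_e2pi_ge(2)[OF t]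
    by (simp add: sum_gp0 norm_divide divide_right_mono del: power_Suc)
  also have "\<dots> \<le> (1 / t + 1 / (1 - t)) / 2"
    by (rule norm_1_minus_e2pi_ge[OF t])
  also have "\<dots> = real Q * ((1 / real a + 1 / real (Q - a)) / 2)"
    using assms by (simp add: t_def of_nat_diff field_simps)
  finally show ?thesis
    using assms by (simp add: window_coeff_def norm_divide field_simps)
qed

text \<open>The frequency 0 contributes (N+1)/Q \<le> 1. The other bounds add up to a harmonic sum,
  by the symmetry between a and Q - a.\<close>

lemma sum_norm_window_coeff_le:
  assumes "N < Q"
  shows "(\<Sum>a<Q. norm (window_coeff Q N a)) \<le> 2 + ln (real Q)"
proof -
  have harm: "harm n \<le> 1 + ln (real Q)" if "n < Q" for n
  proof (cases n)
    case 0
    then show ?thesis using assms by (simp add: harm_def)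
  next
    case (Suc m)
    \<comment> \<open>The difference between the harmonic sum and the logarithm decreases from its
      value 1 at the first index.\<close>
    have "harm (Suc m) - ln (Suc m) \<le> harm (Suc 0) - ln (Suc 0 :: real)"
      using decseqD[OF decseq_harm_diff_ln, of 0 m] by simp
    then have "harm n \<le> 1 + ln (real n)" using Suc by (simp add: harm_def)
    also have "ln (real n) \<le> ln (real Q)" using that Suc by simp
    finally show ?thesis by simp
  qed
  have "(\<Sum>a<Q. norm (window_coeff Q N a)) = norm (window_coeff Q N 0) + (\<Sum>a\<in>{1..<Q}. norm (window_coeff Q N a))"
    using assms by (simp add: lessThan_atLeast0 sum.atLeast_Suc_lessThan)
  also have "norm (window_coeff Q N 0) \<le> 1"
    using assms by (simp add: window_coeff_def norm_divide field_simps flip: of_nat_Suc)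
  also have "(\<Sum>a\<in>{1..<Q}. norm (window_coeff Q N a)) \<le> (\<Sum>a\<in>{1..<Q}. (1 / real a + 1 / real (Q - a)) / 2)"
    by (intro sum_mono norm_window_coeff_le) auto
  also have "\<dots> = ((\<Sum>a\<in>{1..<Q}. 1 / real a) + (\<Sum>a\<in>{1..<Q}. 1 / real (Q - a))) / 2"
    by (simp add: sum.distrib sum_divide_distrib add_divide_distrib)
  also have "(\<Sum>a\<in>{1..<Q}. 1 / real (Q - a)) = (\<Sum>a\<in>{1..<Q}. 1 / real a)"
    by (rule sum.reindex_bij_witness[where i = "\<lambda>a. Q - a" and j = "\<lambda>a. Q - a"]) auto
  also have "(\<Sum>a\<in>{1..<Q}. 1 / real a) = harm (Q - 1)"
    using assms unfolding harm_def by (intro sum.cong) (auto simp: field_simps)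
  finally show ?thesis using harm[of "Q - 1"] assms by simp
qed

section \<open>Shifting the variables\<close>

lemma sum_triangle_swap:
  fixes f :: "nat \<Rightarrow> nat \<Rightarrow> 'a :: comm_monoid_add"
  shows "(\<Sum>j = m..n. \<Sum>i = j..n. f i j) = (\<Sum>i = m..n. \<Sum>j = m..i. f i j)"
  unfolding sum.Sigma[OF finite_atLeastAtMost ballI[OF finite_atLeastAtMost]]
  by (rule sum.reindex_bij_witness[where i = "\<lambda>(i, j). (j, i)" and j = "\<lambda>(j, i). (i, j)"]) auto

text \<open>The fixed coordinate k is not a variable of \<open>triangular_map\<close>, so column k
  of the matrix enters as the translation \<open>m j k * b\<close>. With that translation the map
  acts on the full vector as an upper triangular matrix.\<close>

lemma triangular_map_fun_upd:
  assumes "j \<in> {1..k}" "m k k = real s"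
    and diag: "\<And>j. j \<in> {1..<k} \<Longrightarrow> m j j = real s"
  shows "((triangular_map k s m (\<lambda>j. m j k * b + d j) x)(k := real s * b)) j
       = (\<Sum>i = j..k. m j i * (x(k := b)) i) + (if j = k then 0 else d j)"
proof (cases "j = k")
  case False
  then have j: "j \<in> {1..<k}" using assms by auto
  then have "{j..k} = insert j (insert k {j<..<k})" by auto
  then have "(\<Sum>i = j..k. m j i * (x(k := b)) i) = m j j * x j + (m j k * b + (\<Sum>i\<in>{j<..<k}. m j i * (x(k := b)) i))"
    using j by simp
  also have "(\<Sum>i\<in>{j<..<k}. m j i * (x(k := b)) i) = (\<Sum>i\<in>{j<..<k}. m j i * x i)"
    by (intro sum.cong) auto
  finally show ?thesis
    using j diag[of j] by (simp add: triangular_map_def)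
qed (use assms in simp)

text \<open>Interchanging the two sums moves the matrix, transposed, from the coefficients to
  \<open>v\<close>. In this way a change of variables in the coefficients becomes an identity
  between polynomials.\<close>

lemma linear_form_triangular_map:
  assumes "m k k = real s" "\<And>j. j \<in> {1..<k} \<Longrightarrow> m j j = real s"
  shows "(\<Sum>j = 1..k. ((triangular_map k s m (\<lambda>j. m j k * b + d j) x)(k := real s * b)) j * v j)
       = (\<Sum>i = 1..k. (x(k := b)) i * (\<Sum>j = 1..i. m j i * v j)) + (\<Sum>j = 1..<k. d j * v j)"
proof -
  have "(\<Sum>j = 1..k. ((triangular_map k s m (\<lambda>j. m j k * b + d j) x)(k := real s * b)) j * v j)
      = (\<Sum>j = 1..k. (\<Sum>i = j..k. (x(k := b)) i * (m j i * v j)) + (if j = k then 0 else d j * v j))"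
    using assms
    by (intro sum.cong refl, subst triangular_map_fun_upd) (auto simp: sum_distrib_left algebra_simps)
  also have "\<dots> = (\<Sum>i = 1..k. \<Sum>j = 1..i. (x(k := b)) i * (m j i * v j)) + (\<Sum>j = 1..k. if j = k then 0 else d j * v j)"
    by (simp only: sum.distrib sum_triangle_swap)
  also have "(\<Sum>j = 1..k. if j = k then 0 else d j * v j) = (\<Sum>j = 1..<k. d j * v j)"
    by (intro sum.mono_neutral_cong_right) auto
  finally show ?thesis by (simp only: sum_distrib_left)
qed

text \<open>The substitution \<open>\<alpha>\<^sub>j = \<Sum>\<^sub>i\<^sub>\<ge>\<^sub>j (i choose j) y\<^sup>i\<^sup>-\<^sup>j \<beta>\<^sub>i\<close>, which turns \<open>\<psi>\<^sub>\<alpha>(x)\<close> into \<open>\<psi>\<^sub>\<beta>(x + y) - \<psi>\<^sub>\<beta>(y)\<close>.\<close>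

definition shift_map :: "nat \<Rightarrow> real \<Rightarrow> nat \<Rightarrow> (nat \<Rightarrow> real) \<Rightarrow> nat \<Rightarrow> real" where
  "shift_map k b y = triangular_map k 1 (\<lambda>j i. real (i choose j) * real y ^ (i - j))
     (\<lambda>j. real (k choose j) * real y ^ (k - j) * b + 0)"

text \<open>The frequency paired with \<beta>_i after the substitution:
  \<open>real s * real y ^ i\<close> collects the factors e(-\<psi>(y)) of the s sums, and the
  remainder is \<open>h\<close> under the transposed shift.\<close>

definition shifted_freq :: "nat \<Rightarrow> (nat \<Rightarrow> real) \<Rightarrow> nat \<Rightarrow> nat \<Rightarrow> real" where
  "shifted_freq s h y i = real s * real y ^ i + (\<Sum>j = 1..i. real (i choose j) * real y ^ (i - j) * h j)"

lemma linear_form_shift_map: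
  "(\<Sum>j = 1..k. ((shift_map k b y x)(k := b)) j * v j)
     = (\<Sum>i = 1..k. (x(k := b)) i * (\<Sum>j = 1..i. real (i choose j) * real y ^ (i - j) * v j))"
  using linear_form_triangular_map[of "\<lambda>j i. real (i choose j) * real y ^ (i - j)" k 1 b "\<lambda>_. 0" x v]
  by (simp add: shift_map_def)

lemma binomial_from_1:
  "(\<Sum>j = 1..i. real (i choose j) * real y ^ (i - j) * real x ^ j) = real (x + y) ^ i - real y ^ i"
proof -
  have "real (x + y) ^ i = (\<Sum>j\<le>i. real (i choose j) * real x ^ j * real y ^ (i - j))"
    by (simp add: binomial_ring)
  also have "\<dots> = real y ^ i + (\<Sum>j = 1..i. real (i choose j) * real x ^ j * real y ^ (i - j))"
    by (simp add: atMost_atLeast0 sum.atLeast_Suc_atMost)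
  finally show ?thesis by (simp add: mult_ac)
qed

definition shifted_sum :: "nat \<Rightarrow> nat \<Rightarrow> nat \<Rightarrow> (nat \<Rightarrow> real) \<Rightarrow> complex" where
  "shifted_sum k N y \<beta> = (\<Sum>x\<le>N. e2pi (\<Sum>i = 1..k. \<beta> i * real (x + y) ^ i))"

lemma integrand_shift_map:
  assumes "X \<ge> 0"
  shows "weyl_sum k ((shift_map k b y \<beta>)(k := b)) X ^ s * e2pi (- (\<Sum>j = 1..k. ((shift_map k b y \<beta>)(k := b)) j * h j))
    = shifted_sum k (nat \<lfloor>X\<rfloor>) y (\<beta>(k := b)) ^ s * e2pi (- (\<Sum>i = 1..k. (\<beta>(k := b)) i * shifted_freq s h y i))"
proof -
  let ?u = "\<Sum>i = 1..k. (\<beta>(k := b)) i * real y ^ i"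
  have "weyl_sum k ((shift_map k b y \<beta>)(k := b)) X = shifted_sum k (nat \<lfloor>X\<rfloor>) y (\<beta>(k := b)) * e2pi (- ?u)"
    unfolding weyl_sum_altdef[OF assms] linear_form_shift_map binomial_from_1 shifted_sum_def
    by (simp only: right_diff_distrib sum_subtractf e2pi_diff sum_distrib_right)
  moreover have "(\<Sum>i = 1..k. (\<beta>(k := b)) i * shifted_freq s h y i) = real s * ?u
       + (\<Sum>i = 1..k. (\<beta>(k := b)) i * (\<Sum>j = 1..i. real (i choose j) * real y ^ (i - j) * h j))"
    unfolding shifted_freq_def by (simp only: distrib_left sum.distrib sum_distrib_left mult_ac)
  ultimately show ?thesis
    unfolding linear_form_shift_map
    by (simp add: power_mult_distrib e2pi_power mult.assoc minus_add_distrib flip: e2pi_add)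
qed

text \<open>The left side is free of y, which is what permits averaging over y later. Integrality of
  \<open>h\<close> makes the integrand periodic, and \<open>shift_map\<close> is triangular with
  diagonal 1.\<close>

lemma shifted_integral_eq:
  assumes "X \<ge> 0" and h: "\<And>j. h j \<in> \<int>"
  shows "(LINT \<alpha>:unit_box k | (\<Pi>\<^sub>M j \<in> {1..<k}. lborel).
          weyl_sum k (\<alpha>(k := b)) X ^ s * e2pi (- (\<Sum>j = 1..k. (\<alpha>(k := b)) j * h j)))
    = (LINT \<beta>:unit_box k | (\<Pi>\<^sub>M j \<in> {1..<k}. lborel).
        shifted_sum k (nat \<lfloor>X\<rfloor>) y (\<beta>(k := b)) ^ s * e2pi (- (\<Sum>i = 1..k. (\<beta>(k := b)) i * shifted_freq s h y i)))"
proof -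
  let ?g = "\<lambda>\<alpha>. weyl_sum k (\<alpha>(k := b)) X ^ s * e2pi (- (\<Sum>j = 1..k. (\<alpha>(k := b)) j * h j))"
  have "torus_periodic k ?g"
    unfolding torus_periodic_def
  proof (intro allI impI arg_cong2[where f = "(*)"] arg_cong2[where f = "(^)"] refl)
    fix x y :: "nat \<Rightarrow> real" assume *: "\<forall>j\<in>{1..<k}. x j - y j \<in> \<int>"
    then show "weyl_sum k (x(k := b)) X = weyl_sum k (y(k := b)) X"
      by (intro torus_periodicD[OF weyl_sum_periodic]) auto
    show "e2pi (- (\<Sum>j = 1..k. (x(k := b)) j * h j)) = e2pi (- (\<Sum>j = 1..k. (y(k := b)) j * h j))"
      using e2pi_linear_form_periodic[OF * h, of b] by (simp only: cnj_e2pi[symmetric])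
  qed
  moreover have "?g \<in> borel_measurable (\<Pi>\<^sub>M j \<in> {1..<k}. lborel)"
    by (intro borel_measurable_times borel_measurable_power weyl_sum_measurable
        measurable_compose[OF borel_measurable_uminus[OF linear_form_measurable] e2pi_measurable])
  ultimately have "(LINT \<alpha>:unit_box k | (\<Pi>\<^sub>M j \<in> {1..<k}. lborel). ?g \<alpha>)
      = (LINT \<alpha>:unit_box k | (\<Pi>\<^sub>M j \<in> {1..<k}. lborel). ?g (shift_map k b y \<alpha>))"
    unfolding shift_map_def by (intro integral_triangular_map[symmetric]) auto
  then show ?thesis
    unfolding integrand_shift_map[OF assms(1)] .
qed

text \<open>Translation of the linear coefficient by \<theta>, written as a triangular map so that
  its invariance results apply.\<close>

definition translate_map :: "nat \<Rightarrow> real \<Rightarrow> (nat \<Rightarrow> real) \<Rightarrow> nat \<Rightarrow> real" where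
  "translate_map k \<theta> = triangular_map k 1 (\<lambda>_ _. 0) (\<lambda>j. if j = 1 then \<theta> else 0)"

text \<open>A twist by e(\<theta> z) only changes the linear coefficient. As k \<ge> 2, that
  coefficient is an integrated coordinate and not the fixed leading one.\<close>

lemma weyl_sum_translate_map:
  assumes "k \<ge> 2" "Y \<ge> 0"
  shows "weyl_sum k ((translate_map k \<theta> x)(k := b)) Y
    = (\<Sum>z<Suc (nat \<lfloor>Y\<rfloor>). e2pi (\<Sum>j = 1..k. (x(k := b)) j * real z ^ j) * e2pi (\<theta> * real z))"
proof -
  have "(\<Sum>j = 1..k. ((translate_map k \<theta> x)(k := b)) j * real z ^ j)
      = (\<Sum>j = 1..k. (x(k := b)) j * real z ^ j) + \<theta> * real z" for z
  proof -
    have "(\<Sum>j = 1..k. ((translate_map k \<theta> x)(k := b)) j * real z ^ j)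
       = (\<Sum>j = 1..k. (x(k := b)) j * real z ^ j + (if j = 1 then \<theta> * real z else 0))"
      using assms by (intro sum.cong) (auto simp: translate_map_def triangular_map_def algebra_simps)
    then show ?thesis using assms by (simp add: sum.distrib)
  qed
  then show ?thesis
    using assms by (simp only: weyl_sum_altdef e2pi_add lessThan_Suc_atMost)
qed

text \<open>The choice of Q serves two ends: the residues below Q are exactly the range of a sum of
  length 2X, and y + floor(X) < Q for every admissible y.\<close>

lemma shifted_sum_window:
  assumes "k \<ge> 2" "X \<ge> 0" "y \<le> nat \<lfloor>X\<rfloor>" "Q = Suc (nat \<lfloor>2 * X\<rfloor>)"
  shows "shifted_sum k (nat \<lfloor>X\<rfloor>) y (\<beta>(k := b))
    = (\<Sum>a<Q. window_coeff Q (nat \<lfloor>X\<rfloor>) a * e2pi (- (real a * real y / real Q))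
         * weyl_sum k ((translate_map k (real a / real Q) \<beta>)(k := b)) (2 * X))"
proof -
  have "y + nat \<lfloor>X\<rfloor> < Q" using assms by linarith
  from sum_shifted_window[OF this, of "\<lambda>x. e2pi (\<Sum>i = 1..k. (\<beta>(k := b)) i * real x ^ i)"]
  show ?thesis
    using assms by (simp add: shifted_sum_def weyl_sum_translate_map mult_ac)
qed

text \<open>Collecting powers of \<open>y\<close> in the phase \<open>\<Sum>\<^sub>i \<beta>\<^sub>i u\<^sub>i(y) + \<theta> y\<close>, with \<open>u\<^sub>i\<close> given by \<open>shifted_freq\<close>.\<close>

definition dual_map :: "nat \<Rightarrow> nat \<Rightarrow> (nat \<Rightarrow> real) \<Rightarrow> real \<Rightarrow> real \<Rightarrow> (nat \<Rightarrow> real) \<Rightarrow> nat \<Rightarrow> real" where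
  "dual_map k s h b \<theta> = triangular_map k s (\<lambda>j i. if i = j then real s else real (i choose j) * h (i - j))
     (\<lambda>j. (if k = j then real s else real (k choose j) * h (k - j)) * b + (if j = 1 then \<theta> else 0))"

text \<open>Replacing j by i - j in the binomial sum orders it by powers of y: the constant term is
  \<open>h i\<close>, and the powers below y^i give the off-diagonal entries. The term s y^i
  supplies the diagonal, so the leading coefficient becomes s b, while \<theta> joins the linear
  one.\<close>

lemma linear_form_dual_map:
  assumes "k \<ge> 2"
  shows "(\<Sum>i = 1..k. (\<beta>(k := b)) i * shifted_freq s h y i) + \<theta> * real y
    = (\<Sum>j = 1..k. ((dual_map k s h b \<theta> \<beta>)(k := real s * b)) j * real y ^ j) + (\<Sum>i = 1..k. (\<beta>(k := b)) i * h i)"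
proof -
  have freq: "shifted_freq s h y i = (\<Sum>j = 1..i. (if i = j then real s else real (i choose j) * h (i - j)) * real y ^ j) + h i"
    if "i \<in> {1..k}" for i
  proof -
    from that obtain n where i: "i = Suc n" by (cases i) auto
    have "(\<Sum>j = 1..i. real (i choose j) * real y ^ (i - j) * h j) = h i + (\<Sum>j = 1..n. real (i choose j) * real y ^ (i - j) * h j)"
      by (simp add: i)
    also have "(\<Sum>j = 1..n. real (i choose j) * real y ^ (i - j) * h j) = (\<Sum>j = 1..n. real (i choose j) * real y ^ j * h (i - j))"
      by (rule sum.reindex_bij_witness[where i = "\<lambda>j. i - j" and j = "\<lambda>j. i - j"])
         (auto simp: i binomial_symmetric[symmetric])
    also have "\<dots> = (\<Sum>j = 1..n. (if i = j then real s else real (i choose j) * h (i - j)) * real y ^ j)"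
      by (intro sum.cong) (auto simp: i)
    finally show ?thesis
      by (simp add: shifted_freq_def i)
  qed
  have "(\<Sum>j = 1..k. ((dual_map k s h b \<theta> \<beta>)(k := real s * b)) j * real y ^ j)
      = (\<Sum>i = 1..k. (\<beta>(k := b)) i * (\<Sum>j = 1..i. (if i = j then real s else real (i choose j) * h (i - j)) * real y ^ j))
        + (\<Sum>j = 1..<k. (if j = 1 then \<theta> else 0) * real y ^ j)"
    unfolding dual_map_def by (rule linear_form_triangular_map) auto
  also have "(\<Sum>j = 1..<k. (if j = 1 then \<theta> else 0) * real y ^ j) = (\<Sum>j = 1..<k. if j = 1 then \<theta> * real y else 0)"
    by (intro sum.cong) auto
  also have "\<dots> = \<theta> * real y" using assms by simp
  finally show ?thesis
    by (simp add: freq distrib_left sum.distrib)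
qed

text \<open>The sum over y is a conjugated Weyl sum times a phase free of y; neither the conjugation
  nor the phase changes the norm.\<close>

lemma norm_sum_shifted_freq:
  assumes "k \<ge> 2" "X \<ge> 0"
  shows "norm (\<Sum>y\<le>nat \<lfloor>X\<rfloor>. e2pi (- (\<theta> * real y)) * e2pi (- (\<Sum>i = 1..k. (\<beta>(k := b)) i * shifted_freq s h y i)))
    = norm (weyl_sum k ((dual_map k s h b \<theta> \<beta>)(k := real s * b)) X)"
proof -
  let ?c = "e2pi (- (\<Sum>i = 1..k. (\<beta>(k := b)) i * h i))"
  have "e2pi (- (\<theta> * real y)) * e2pi (- (\<Sum>i = 1..k. (\<beta>(k := b)) i * shifted_freq s h y i))
     = cnj (e2pi (\<Sum>j = 1..k. ((dual_map k s h b \<theta> \<beta>)(k := real s * b)) j * real y ^ j)) * ?c" for y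
    unfolding cnj_e2pi e2pi_add[symmetric]
    using linear_form_dual_map[OF assms(1), of \<beta> b s h y \<theta>] by (intro arg_cong[where f = e2pi]) linarith
  then have "(\<Sum>y\<le>nat \<lfloor>X\<rfloor>. e2pi (- (\<theta> * real y)) * e2pi (- (\<Sum>i = 1..k. (\<beta>(k := b)) i * shifted_freq s h y i)))
     = cnj (weyl_sum k ((dual_map k s h b \<theta> \<beta>)(k := real s * b)) X) * ?c"
    by (simp only: weyl_sum_altdef[OF assms(2)] cnj_sum sum_distrib_right)
  then show ?thesis by (simp add: norm_mult)
qed

section \<open>Moments over the unit box\<close>

definition box_moment :: "nat \<Rightarrow> nat \<Rightarrow> real \<Rightarrow> real \<Rightarrow> ennreal" where
  "box_moment t k b Y = (\<integral>\<^sup>+ \<alpha> \<in> unit_box k. ennreal (cmod (weyl_sum k (\<alpha>(k := b)) Y) ^ t) \<partial>(\<Pi>\<^sub>M j \<in> {1..<k}. lborel))"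

lemma box_moment_measurable [measurable]: "(\<lambda>b. box_moment t k b Y) \<in> borel_measurable borel"
proof -
  interpret sigma_finite_measure "\<Pi>\<^sub>M j \<in> {1..<k}. (lborel :: real measure)"
    by (rule lborel_product.sigma_finite) simp
  have "(\<lambda>(b, \<alpha>). ennreal (cmod (weyl_sum k (\<alpha>(k := b)) Y) ^ t) * indicator (unit_box k) \<alpha>)
      \<in> borel_measurable (borel \<Otimes>\<^sub>M (\<Pi>\<^sub>M j \<in> {1..<k}. lborel))"
    using weyl_sum_measurable_pair[of k Y] unfolding case_prod_beta by measurable
  from borel_measurable_nn_integral[OF this] show ?thesis
    unfolding box_moment_def by simp
qed

lemma emeasure_unit_box: "emeasure (\<Pi>\<^sub>M j \<in> {1..<k}. lborel) (unit_box k) = 1"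
  unfolding unit_box_def by (subst lborel_product.emeasure_PiM) auto

text \<open>Finiteness for each fixed b allows real-valued roots of the moments in the integration
  over b.\<close>

lemma box_moment_finite: "box_moment t k b Y < \<infinity>"
proof -
  define K where "K = real (card {x. real x \<le> Y})"
  have "norm (weyl_sum k \<alpha> Y) \<le> K" for \<alpha>
    unfolding weyl_sum_def K_def by (rule order_trans[OF norm_sum]) simp
  then have "box_moment t k b Y \<le> (\<integral>\<^sup>+ \<alpha> \<in> unit_box k. ennreal (K ^ t) \<partial>(\<Pi>\<^sub>M j \<in> {1..<k}. lborel))"
    unfolding box_moment_def
    by (intro nn_integral_mono mult_right_mono ennreal_leI power_mono) auto
  also have "\<dots> = ennreal (K ^ t)"
    by (subst nn_integral_cmult_indicator) (simp_all only: unit_box_measurable emeasure_unit_box mult_1_right)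
  finally show ?thesis by (auto simp: order_le_less_trans)
qed

text \<open>Applied to \<open>translate_map\<close> and \<open>dual_map\<close>, this makes the
  moments of the twisted sums independent of the twist.\<close>

lemma box_moment_triangular_map:
  assumes "s \<ge> 1"
  shows "(\<integral>\<^sup>+ \<alpha> \<in> unit_box k. ennreal (cmod (weyl_sum k ((triangular_map k s m d \<alpha>)(k := b)) Y) ^ t) \<partial>(\<Pi>\<^sub>M j \<in> {1..<k}. lborel))
    = box_moment t k b Y"
  unfolding box_moment_def
proof (rule nn_integral_triangular_map[OF assms, where g = "\<lambda>\<alpha>. ennreal (cmod (weyl_sum k (\<alpha>(k := b)) Y) ^ t)"])
  show "torus_periodic k (\<lambda>\<alpha>. ennreal (cmod (weyl_sum k (\<alpha>(k := b)) Y) ^ t))"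
    using weyl_sum_periodic[of k b Y] unfolding torus_periodic_def by metis
qed measurable

text \<open>The arithmetic-geometric mean inequality replaces the product of s factors by the mean
  of their s-th powers. Each term then falls under Hoelder's inequality for two functions, with the
  same bound because all factors share the moment \<open>A\<close>.\<close>

lemma nn_integral_prod_Holder_le:
  fixes F :: "'i \<Rightarrow> 'a \<Rightarrow> complex"
  assumes [measurable]: "\<And>i. F i \<in> borel_measurable M" "W \<in> borel_measurable M"
    and I: "finite I" "I \<noteq> {}" "card I = s"
    and F: "\<And>i. i \<in> I \<Longrightarrow> (\<integral>\<^sup>+x. ennreal (cmod (F i x) ^ Suc s) \<partial>M) = A"
    and W: "(\<integral>\<^sup>+x. ennreal (cmod (W x) ^ Suc s) \<partial>M) = D"
  shows "(\<integral>\<^sup>+x. ennreal ((\<Prod>i\<in>I. cmod (F i x)) * cmod (W x)) \<partial>M)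
    \<le> ennreal_powr A (real s / (real s + 1)) * ennreal_powr D (1 / (real s + 1))"
proof -
  have "s \<ge> 1" using I by (metis One_nat_def Suc_leI card_gt_0_iff)
  have "(\<integral>\<^sup>+x. ennreal ((\<Prod>i\<in>I. cmod (F i x)) * cmod (W x)) \<partial>M)
     \<le> (\<integral>\<^sup>+x. ennreal (1 / s) * (\<Sum>i\<in>I. ennreal (cmod (F i x) ^ s * cmod (W x))) \<partial>M)"
  proof (rule nn_integral_mono)
    fix x
    have "(\<Prod>i\<in>I. cmod (F i x)) * cmod (W x) \<le> (\<Sum>i\<in>I. cmod (F i x) ^ s) / s * cmod (W x)"
      using prod_le_mean_power[OF I(1,2), of "\<lambda>i. cmod (F i x)"] I(3) by (intro mult_right_mono) auto
    also have "\<dots> = 1 / s * (\<Sum>i\<in>I. cmod (F i x) ^ s * cmod (W x))"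
      by (simp add: sum_distrib_right)
    finally have "ennreal ((\<Prod>i\<in>I. cmod (F i x)) * cmod (W x)) \<le> ennreal (1 / s * (\<Sum>i\<in>I. cmod (F i x) ^ s * cmod (W x)))"
      by (rule ennreal_leI)
    also have "\<dots> = ennreal (1 / s) * ennreal (\<Sum>i\<in>I. cmod (F i x) ^ s * cmod (W x))"
      by (intro ennreal_mult sum_nonneg) auto
    also have "ennreal (\<Sum>i\<in>I. cmod (F i x) ^ s * cmod (W x)) = (\<Sum>i\<in>I. ennreal (cmod (F i x) ^ s * cmod (W x)))"
      by (intro sum_ennreal[symmetric]) auto
    finally show "ennreal ((\<Prod>i\<in>I. cmod (F i x)) * cmod (W x)) \<le> ennreal (1 / s) * (\<Sum>i\<in>I. ennreal (cmod (F i x) ^ s * cmod (W x)))" .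
  qed
  also have "\<dots> = ennreal (1 / s) * (\<Sum>i\<in>I. (\<integral>\<^sup>+x. ennreal (cmod (F i x) ^ s * cmod (W x)) \<partial>M))"
    by (simp add: nn_integral_cmult nn_integral_sum del: sum_ennreal)
  also have "\<dots> \<le> ennreal (1 / s) * (\<Sum>i\<in>I. ennreal_powr A (real s / (real s + 1)) * ennreal_powr D (1 / (real s + 1)))"
  proof (intro mult_left_mono sum_mono)
    fix i assume "i \<in> I"
    show "(\<integral>\<^sup>+x. ennreal (cmod (F i x) ^ s * cmod (W x)) \<partial>M)
       \<le> ennreal_powr A (real s / (real s + 1)) * ennreal_powr D (1 / (real s + 1))"
      using nn_integral_Holder_power[of "\<lambda>x. cmod (F i x)" M "\<lambda>x. cmod (W x)" s] \<open>s \<ge> 1\<close>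
      unfolding F[OF \<open>i \<in> I\<close>] W by simp
  qed simp
  also have "\<dots> = ennreal (1 / s) * of_nat s * (ennreal_powr A (real s / (real s + 1)) * ennreal_powr D (1 / (real s + 1)))"
    by (simp add: I mult_ac)
  also have "ennreal (1 / s) * of_nat s = 1"
    using \<open>s \<ge> 1\<close> by (simp add: ennreal_of_nat_eq_real_of_nat flip: ennreal_mult)
  finally show ?thesis by simp
qed

text \<open>Expanding the s-th power picks a frequency \<phi> l for each of the s factors. The
  variable y then survives only in phases, and interchanging the sums isolates the sum over y, with
  the s twists merged into one.\<close>

lemma integrand_average_expansion:
  assumes "k \<ge> 2" "X \<ge> 0" "Q = Suc (nat \<lfloor>2 * X\<rfloor>)"
  shows "(\<Sum>y\<le>nat \<lfloor>X\<rfloor>. shifted_sum k (nat \<lfloor>X\<rfloor>) y (\<beta>(k := b)) ^ s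
            * e2pi (- (\<Sum>i = 1..k. (\<beta>(k := b)) i * shifted_freq s h y i)))
    = (\<Sum>\<phi>\<in>{..<s} \<rightarrow>\<^sub>E {..<Q}. (\<Prod>l<s. window_coeff Q (nat \<lfloor>X\<rfloor>) (\<phi> l))
         * (\<Prod>l<s. weyl_sum k ((translate_map k (real (\<phi> l) / real Q) \<beta>)(k := b)) (2 * X))
         * (\<Sum>y\<le>nat \<lfloor>X\<rfloor>. e2pi (- ((\<Sum>l<s. real (\<phi> l) / real Q) * real y))
              * e2pi (- (\<Sum>i = 1..k. (\<beta>(k := b)) i * shifted_freq s h y i))))"
proof -
  let ?N = "nat \<lfloor>X\<rfloor>"
  let ?c = "window_coeff Q ?N"
  let ?F = "\<lambda>a. weyl_sum k ((translate_map k (real a / real Q) \<beta>)(k := b)) (2 * X)"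
  let ?u = "\<lambda>y. e2pi (- (\<Sum>i = 1..k. (\<beta>(k := b)) i * shifted_freq s h y i))"
  have pow: "shifted_sum k ?N y (\<beta>(k := b)) ^ s
     = (\<Sum>\<phi>\<in>{..<s} \<rightarrow>\<^sub>E {..<Q}. (\<Prod>l<s. ?c (\<phi> l)) * (\<Prod>l<s. ?F (\<phi> l)) * e2pi (- ((\<Sum>l<s. real (\<phi> l) / real Q) * real y)))"
    if "y \<le> ?N" for y
  proof -
    have "shifted_sum k ?N y (\<beta>(k := b)) ^ s = (\<Prod>l<s. \<Sum>a<Q. ?c a * e2pi (- (real a * real y / real Q)) * ?F a)"
      unfolding shifted_sum_window[OF assms(1,2) that assms(3)] by simp
    also have "\<dots> = (\<Sum>\<phi>\<in>{..<s} \<rightarrow>\<^sub>E {..<Q}. \<Prod>l<s. ?c (\<phi> l) * e2pi (- (real (\<phi> l) * real y / real Q)) * ?F (\<phi> l))"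
      by (rule prod_sum_PiE) auto
    also have "\<dots> = (\<Sum>\<phi>\<in>{..<s} \<rightarrow>\<^sub>E {..<Q}. (\<Prod>l<s. ?c (\<phi> l)) * (\<Prod>l<s. ?F (\<phi> l)) * e2pi (- ((\<Sum>l<s. real (\<phi> l) / real Q) * real y)))"
    proof (intro sum.cong refl)
      fix \<phi> :: "nat \<Rightarrow> nat"
      have "- ((\<Sum>l<s. real (\<phi> l) / real Q) * real y) = (\<Sum>l<s. - (real (\<phi> l) * real y / real Q))"
        by (simp add: sum_distrib_right sum_negf)
      then have "e2pi (- ((\<Sum>l<s. real (\<phi> l) / real Q) * real y)) = (\<Prod>l<s. e2pi (- (real (\<phi> l) * real y / real Q)))"
        by (simp only: e2pi_sum)
      then show "(\<Prod>l<s. ?c (\<phi> l) * e2pi (- (real (\<phi> l) * real y / real Q)) * ?F (\<phi> l))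
        = (\<Prod>l<s. ?c (\<phi> l)) * (\<Prod>l<s. ?F (\<phi> l)) * e2pi (- ((\<Sum>l<s. real (\<phi> l) / real Q) * real y))"
        by (simp only: prod.distrib mult_ac)
    qed
    finally show ?thesis .
  qed
  have "(\<Sum>y\<le>?N. shifted_sum k ?N y (\<beta>(k := b)) ^ s * ?u y)
    = (\<Sum>y\<le>?N. \<Sum>\<phi>\<in>{..<s} \<rightarrow>\<^sub>E {..<Q}. (\<Prod>l<s. ?c (\<phi> l)) * (\<Prod>l<s. ?F (\<phi> l)) * (e2pi (- ((\<Sum>l<s. real (\<phi> l) / real Q) * real y)) * ?u y))"
    by (intro sum.cong refl) (simp only: pow atMost_iff sum_distrib_right mult.assoc)
  also have "\<dots> = (\<Sum>\<phi>\<in>{..<s} \<rightarrow>\<^sub>E {..<Q}. \<Sum>y\<le>?N. (\<Prod>l<s. ?c (\<phi> l)) * (\<Prod>l<s. ?F (\<phi> l)) * (e2pi (- ((\<Sum>l<s. real (\<phi> l) / real Q) * real y)) * ?u y))"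
    by (rule sum.swap)
  finally show ?thesis by (simp only: sum_distrib_left)
qed

section \<open>Bounding the inner integral for a fixed leading coefficient\<close>

lemma translate_map_measurable [measurable]:
  "translate_map k \<theta> \<in> (\<Pi>\<^sub>M j \<in> {1..<k}. lborel) \<rightarrow>\<^sub>M (\<Pi>\<^sub>M j \<in> {1..<k}. lborel)"
  unfolding translate_map_def by measurable

lemma dual_map_measurable [measurable]:
  "dual_map k s h b \<theta> \<in> (\<Pi>\<^sub>M j \<in> {1..<k}. lborel) \<rightarrow>\<^sub>M (\<Pi>\<^sub>M j \<in> {1..<k}. lborel)"
  unfolding dual_map_def by measurable

lemma shifted_sum_measurable [measurable]:
  "(\<lambda>\<beta>. shifted_sum k N y (\<beta>(k := b))) \<in> borel_measurable (\<Pi>\<^sub>M j \<in> {1..<k}. lborel)"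
  unfolding shifted_sum_def
  by (intro borel_measurable_sum measurable_compose[OF linear_form_measurable e2pi_measurable])

text \<open>The floor(X) + 1 equal copies of the integral, one for each y, add up to the integral of
  the expanded sum. Each frequency tuple contributes s sums of length 2X and one of length X, and
  Hoelder's inequality bounds them by two moments common to all tuples.\<close>

lemma inner_integral_bound:
  assumes "k \<ge> 2" "s \<ge> 1" "X \<ge> 0" and h: "\<And>j. h j \<in> \<int>" and Q: "Q = Suc (nat \<lfloor>2 * X\<rfloor>)"
  shows "ennreal (real (Suc (nat \<lfloor>X\<rfloor>)) * norm (LINT \<alpha>:unit_box k | (\<Pi>\<^sub>M j \<in> {1..<k}. lborel).
          weyl_sum k (\<alpha>(k := b)) X ^ s * e2pi (- (\<Sum>j = 1..k. (\<alpha>(k := b)) j * h j))))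
    \<le> ennreal ((\<Sum>a<Q. norm (window_coeff Q (nat \<lfloor>X\<rfloor>) a)) ^ s)
      * (ennreal_powr (box_moment (Suc s) k b (2 * X)) (real s / (real s + 1))
         * ennreal_powr (box_moment (Suc s) k (real s * b) X) (1 / (real s + 1)))"
proof -
  let ?N = "nat \<lfloor>X\<rfloor>"
  let ?P = "\<Pi>\<^sub>M j \<in> {1..<k}. (lborel :: real measure)"
  define M where "M = restrict_space ?P (unit_box k)"
  define G where "G = (LINT \<alpha>:unit_box k | ?P. weyl_sum k (\<alpha>(k := b)) X ^ s * e2pi (- (\<Sum>j = 1..k. (\<alpha>(k := b)) j * h j)))"
  define R where "R y \<beta> = shifted_sum k ?N y (\<beta>(k := b)) ^ s
      * e2pi (- (\<Sum>i = 1..k. (\<beta>(k := b)) i * shifted_freq s h y i))" for y \<beta>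
  define F where "F a \<beta> = weyl_sum k ((translate_map k (real a / real Q) \<beta>)(k := b)) (2 * X)" for a \<beta>
  define W where "W \<theta> \<beta> = weyl_sum k ((dual_map k s h b \<theta> \<beta>)(k := real s * b)) X" for \<theta> \<beta>
  define c where "c = window_coeff Q ?N"
  have M_meas: "f \<in> borel_measurable M" if "f \<in> borel_measurable ?P" for f :: "(nat \<Rightarrow> real) \<Rightarrow> complex"
    using that unfolding M_def by (rule measurable_restrict_space1)
  have nn_M: "(\<integral>\<^sup>+x. f x \<partial>M) = (\<integral>\<^sup>+x. f x * indicator (unit_box k) x \<partial>?P)" for f
    unfolding M_def by (rule nn_integral_restrict_space) (simp add: sets.Int_space_eq2 unit_box_measurable del: One_nat_def)
  have "space M = unit_box k"
    unfolding M_def space_restrict_space using sets.sets_into_space[OF unit_box_measurable[of k]] by auto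
  moreover have "emeasure M (unit_box k) = 1"
    unfolding M_def by (subst emeasure_restrict_space) (simp_all add: emeasure_unit_box sets.Int_space_eq2 del: One_nat_def)
  ultimately interpret finite_measure M
    by (intro finite_measureI) simp
  have int_M: "(LINT \<beta>:unit_box k | ?P. f \<beta>) = integral\<^sup>L M f" for f :: "(nat \<Rightarrow> real) \<Rightarrow> complex"
    unfolding M_def set_lebesgue_integral_def
    by (rule integral_restrict_space[symmetric]) (simp add: sets.Int_space_eq2 unit_box_measurable del: One_nat_def)
  have R_int: "integrable M (R y)" for y
  proof (rule integrable_const_bound[where B = "real (Suc ?N) ^ s"])
    have "norm (shifted_sum k ?N y \<beta>) \<le> real (Suc ?N)" for \<beta>
      unfolding shifted_sum_def by (rule order_trans[OF norm_sum]) simp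
    then show "AE \<beta> in M. norm (R y \<beta>) \<le> real (Suc ?N) ^ s"
      unfolding R_def norm_mult norm_power norm_e2pi mult_1_right by (intro always_eventually allI power_mono) auto
    show "R y \<in> borel_measurable M"
      unfolding R_def
      by (intro M_meas borel_measurable_times borel_measurable_power shifted_sum_measurable
        measurable_compose[OF borel_measurable_uminus[OF linear_form_measurable] e2pi_measurable])
  qed
  have "G = integral\<^sup>L M (R y)" for y
    unfolding G_def shifted_integral_eq[OF \<open>X \<ge> 0\<close> h, where y = y] R_def by (rule int_M)
  then have "of_nat (Suc ?N) * G = (\<Sum>y\<le>?N. integral\<^sup>L M (R y))"
    by simp
  also have "\<dots> = integral\<^sup>L M (\<lambda>\<beta>. \<Sum>y\<le>?N. R y \<beta>)"
    using R_int by (simp add: Bochner_Integration.integral_sum)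
  finally have "ennreal (real (Suc ?N) * norm G) = ennreal (norm (integral\<^sup>L M (\<lambda>\<beta>. \<Sum>y\<le>?N. R y \<beta>)))"
    by (metis norm_mult norm_of_nat)
  also have "\<dots> \<le> (\<integral>\<^sup>+\<beta>. ennreal (norm (\<Sum>y\<le>?N. R y \<beta>)) \<partial>M)"
    using R_int by (intro integral_norm_bound_ennreal Bochner_Integration.integrable_sum)
  also have "\<dots> \<le> (\<integral>\<^sup>+\<beta>. (\<Sum>\<phi>\<in>{..<s} \<rightarrow>\<^sub>E {..<Q}. ennreal (\<Prod>l<s. norm (c (\<phi> l)))
       * ennreal ((\<Prod>l<s. norm (F (\<phi> l) \<beta>)) * norm (W (\<Sum>l<s. real (\<phi> l) / real Q) \<beta>))) \<partial>M)"
  proof (rule nn_integral_mono)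
    fix \<beta>
    have "norm (\<Sum>y\<le>?N. R y \<beta>) \<le> (\<Sum>\<phi>\<in>{..<s} \<rightarrow>\<^sub>E {..<Q}. (\<Prod>l<s. norm (c (\<phi> l)))
       * ((\<Prod>l<s. norm (F (\<phi> l) \<beta>)) * norm (W (\<Sum>l<s. real (\<phi> l) / real Q) \<beta>)))"
      unfolding R_def integrand_average_expansion[OF \<open>k \<ge> 2\<close> \<open>X \<ge> 0\<close> Q]
      by (rule order_trans[OF norm_sum])
         (simp only: norm_mult prod_norm[symmetric] norm_sum_shifted_freq[OF \<open>k \<ge> 2\<close> \<open>X \<ge> 0\<close>] c_def F_def W_def mult.assoc order_refl)
    then have "ennreal (norm (\<Sum>y\<le>?N. R y \<beta>)) \<le> ennreal (\<Sum>\<phi>\<in>{..<s} \<rightarrow>\<^sub>E {..<Q}. (\<Prod>l<s. norm (c (\<phi> l)))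
       * ((\<Prod>l<s. norm (F (\<phi> l) \<beta>)) * norm (W (\<Sum>l<s. real (\<phi> l) / real Q) \<beta>)))"
      by (rule ennreal_leI)
    also have "\<dots> = (\<Sum>\<phi>\<in>{..<s} \<rightarrow>\<^sub>E {..<Q}. ennreal (\<Prod>l<s. norm (c (\<phi> l)))
       * ennreal ((\<Prod>l<s. norm (F (\<phi> l) \<beta>)) * norm (W (\<Sum>l<s. real (\<phi> l) / real Q) \<beta>)))"
    proof -
      have nonneg: "(\<Prod>l<s. norm (c (\<phi> l))) \<ge> 0"
        "(\<Prod>l<s. norm (F (\<phi> l) \<beta>)) * norm (W (\<Sum>l<s. real (\<phi> l) / real Q) \<beta>) \<ge> 0" for \<phi>
        by (simp_all add: prod_nonneg)
      show ?thesis
        unfolding ennreal_mult[OF nonneg, symmetric]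
        by (rule sum_ennreal[symmetric]) (rule mult_nonneg_nonneg[OF nonneg])
    qed
    finally show "ennreal (norm (\<Sum>y\<le>?N. R y \<beta>)) \<le> \<dots>" .
  qed
  also have "\<dots> = (\<Sum>\<phi>\<in>{..<s} \<rightarrow>\<^sub>E {..<Q}. ennreal (\<Prod>l<s. norm (c (\<phi> l)))
       * (\<integral>\<^sup>+\<beta>. ennreal ((\<Prod>l<s. norm (F (\<phi> l) \<beta>)) * norm (W (\<Sum>l<s. real (\<phi> l) / real Q) \<beta>)) \<partial>M))"
  proof -
    have [measurable]: "F a \<in> borel_measurable M" "W \<theta> \<in> borel_measurable M" for a \<theta>
      unfolding F_def W_def
      by (intro M_meas measurable_compose[OF translate_map_measurable weyl_sum_measurable]
          measurable_compose[OF dual_map_measurable weyl_sum_measurable])+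
    have V: "(\<lambda>\<beta>. ennreal ((\<Prod>l<s. norm (F (\<phi> l) \<beta>)) * norm (W (\<Sum>l<s. real (\<phi> l) / real Q) \<beta>))) \<in> borel_measurable M" for \<phi>
      by measurable
    show ?thesis
      unfolding nn_integral_cmult[OF V, symmetric]
      by (rule nn_integral_sum) (intro borel_measurable_times_ennreal V, simp)
  qed
  also have "\<dots> \<le> (\<Sum>\<phi>\<in>{..<s} \<rightarrow>\<^sub>E {..<Q}. ennreal (\<Prod>l<s. norm (c (\<phi> l)))
       * (ennreal_powr (box_moment (Suc s) k b (2 * X)) (real s / (real s + 1))
         * ennreal_powr (box_moment (Suc s) k (real s * b) X) (1 / (real s + 1))))"
  proof (intro sum_mono mult_left_mono nn_integral_prod_Holder_le)
    fix \<phi> :: "nat \<Rightarrow> nat" and l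
    show "F (\<phi> l) \<in> borel_measurable M"
      unfolding F_def by (intro M_meas measurable_compose[OF translate_map_measurable weyl_sum_measurable])
    show "(\<integral>\<^sup>+ \<beta>. ennreal (cmod (F (\<phi> l) \<beta>) ^ Suc s) \<partial>M) = box_moment (Suc s) k b (2 * X)"
      unfolding F_def nn_M translate_map_def by (rule box_moment_triangular_map) simp
    show "(\<integral>\<^sup>+ \<beta>. ennreal (cmod (W (\<Sum>l<s. real (\<phi> l) / real Q) \<beta>) ^ Suc s) \<partial>M) = box_moment (Suc s) k (real s * b) X"
      unfolding W_def nn_M dual_map_def by (rule box_moment_triangular_map[OF \<open>s \<ge> 1\<close>])
    show "W (\<Sum>l<s. real (\<phi> l) / real Q) \<in> borel_measurable M"
      unfolding W_def by (intro M_meas measurable_compose[OF dual_map_measurable weyl_sum_measurable])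
  qed (use \<open>s \<ge> 1\<close> in \<open>auto simp: lessThan_empty_iff\<close>)
  also have "\<dots> = ennreal (\<Sum>\<phi>\<in>{..<s} \<rightarrow>\<^sub>E {..<Q}. \<Prod>l<s. norm (c (\<phi> l)))
       * (ennreal_powr (box_moment (Suc s) k b (2 * X)) (real s / (real s + 1))
         * ennreal_powr (box_moment (Suc s) k (real s * b) X) (1 / (real s + 1)))"
    unfolding sum_distrib_right[symmetric]
    by (intro arg_cong2[where f = "(*)"] sum_ennreal refl prod_nonneg) simp
  \<comment> \<open>The moment bound is the same for all \<phi>, so only coefficient products are
    left to sum, and these factor into an s-th power.\<close>
  also have "(\<Sum>\<phi>\<in>{..<s} \<rightarrow>\<^sub>E {..<Q}. \<Prod>l<s. norm (c (\<phi> l))) = (\<Sum>a<Q. norm (c a)) ^ s"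
    using prod_sum_PiE[of "{..<s}" "\<lambda>_. {..<Q}" "\<lambda>_ a. norm (c a)"] by simp
  finally show ?thesis unfolding G_def c_def .
qed

section \<open>Integration over the leading coefficient\<close>

lemma ennreal_powr_mono: "x \<le> y \<Longrightarrow> a \<ge> 0 \<Longrightarrow> ennreal_powr x a \<le> ennreal_powr y a"
  unfolding ennreal_powr_def
  by (cases "y = \<infinity>") (auto simp: top_unique less_top intro!: ennreal_leI powr_mono2 enn2real_mono)

lemma J_star_eq_box_moment: "J_star t k B Y = (\<integral>\<^sup>+ b \<in> B. box_moment t k b Y \<partial>lebesgue)"
  unfolding J_star_def box_moment_def ..

text \<open>Linear substitution with Jacobian s. The dilated set is Lebesgue measurable because it
  is the preimage of B under division by s.\<close>

lemma J_star_dilate: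
  assumes "s \<ge> 1" and B: "B \<in> sets lebesgue"
  shows "J_star t k ((\<lambda>b. real s * b) ` B) Y = ennreal (real s) * (\<integral>\<^sup>+ b \<in> B. box_moment t k (real s * b) Y \<partial>lebesgue)"
proof -
  have ind: "indicator ((\<lambda>b. real s * b) ` B) (0 + real s * b) = (indicator B b :: ennreal)" for b
    using \<open>s \<ge> 1\<close> by (auto simp: indicator_def)
  \<comment> \<open>On the real line this map is x -> x/s, written in the coordinate form of
    \<open>lebesgue_affine_measurable\<close>.\<close>
  have dil: "(\<lambda>x. 0 + (\<Sum>j\<in>Basis. (1 / real s * (x \<bullet> j)) *\<^sub>R j)) \<in> lebesgue \<rightarrow>\<^sub>M (lebesgue :: real measure)"
    using \<open>s \<ge> 1\<close> by (intro lebesgue_affine_measurable) simp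
  have "(\<lambda>b. real s * b) ` B = (\<lambda>x. 0 + (\<Sum>j\<in>Basis. (1 / real s * (x \<bullet> j)) *\<^sub>R j)) -` B \<inter> space lebesgue"
  proof (intro set_eqI)
    fix x
    have "x \<in> (\<lambda>b. real s * b) ` B \<longleftrightarrow> x / real s \<in> B"
      using \<open>s \<ge> 1\<close> by (auto simp: image_iff intro!: bexI[of _ "x / real s"])
    then show "x \<in> (\<lambda>b. real s * b) ` B \<longleftrightarrow> x \<in> (\<lambda>x. 0 + (\<Sum>j\<in>Basis. (1 / real s * (x \<bullet> j)) *\<^sub>R j)) -` B \<inter> space lebesgue"
      by simp
  qed
  also have "\<dots> \<in> sets lebesgue"
    by (rule measurable_sets[OF dil B])
  finally have [measurable]: "(\<lambda>b. real s * b) ` B \<in> sets lebesgue" .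
  have [measurable]: "(\<lambda>b. box_moment t k b Y) \<in> borel_measurable lebesgue"
    by (rule measurable_completion) simp
  have "J_star t k ((\<lambda>b. real s * b) ` B) Y
    = ennreal \<bar>real s\<bar> * (\<integral>\<^sup>+ b. box_moment t k (0 + real s * b) Y * indicator ((\<lambda>b. real s * b) ` B) (0 + real s * b) \<partial>lebesgue)"
    unfolding J_star_eq_box_moment using \<open>s \<ge> 1\<close>
    by (intro nn_integral_real_affine_lebesgue) auto
  then show ?thesis unfolding ind by simp
qed

text \<open>For X \<ge> 3 one has Q \<le> 2X + 1 \<le> X^2, and also ln X \<ge> 1 since e \<le> 3.
  Hence 2 + ln Q is at most 4 ln X.\<close>

lemma sum_norm_window_coeff_le_ln:
  assumes "X \<ge> 3" "Q = Suc (nat \<lfloor>2 * X\<rfloor>)"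
  shows "(\<Sum>a<Q. norm (window_coeff Q (nat \<lfloor>X\<rfloor>) a)) \<le> 4 * ln X"
proof -
  have "nat \<lfloor>X\<rfloor> < Q" using assms by linarith
  then have "(\<Sum>a<Q. norm (window_coeff Q (nat \<lfloor>X\<rfloor>) a)) \<le> 2 + ln (real Q)"
    by (rule sum_norm_window_coeff_le)
  moreover have "ln (real Q) \<le> 2 * ln X"
  proof -
    have "real Q \<le> 2 * X + 1" using assms by simp
    also have "\<dots> \<le> 3 * X" using assms by simp
    also have "\<dots> \<le> X ^ 2" using assms by (simp add: power2_eq_square)
    finally have "ln (real Q) \<le> ln (X ^ 2)" using assms(2) by (intro ln_mono) auto
    then show ?thesis using assms by (simp add: ln_realpow)
  qed
  moreover have "1 \<le> ln X" using assms exp_le by (subst ln_ge_iff) auto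
  ultimately show ?thesis by simp
qed

theorem theorem2p1:
  fixes k s :: nat
  assumes "k \<ge> 2" and "s \<ge> 1"
  shows "\<exists>C > 0. \<exists>X\<^sub>0 > 0. \<forall>(X :: real) \<ge> X\<^sub>0. \<forall>(h :: nat \<Rightarrow> int) (B :: real set).
    B \<in> sets lebesgue \<longrightarrow>
    ennreal (cmod (I_int k s B X h))
      \<le> ennreal (C * X powr (- 1) * ln X ^ s)
        * ennreal_powr (J_star (s + 1) k B (2 * X)) (real s / (real s + 1))
        * ennreal_powr (J_star (s + 1) k ((\<lambda>b. real s * b) ` B) X) (1 / (real s + 1))"
\<comment> \<open>Each of the s window expansions costs a factor of at most 4 ln X once X \<ge> 3;
  this explains both witnesses.\<close>
proof (rule exI[of _ "4 ^ s"], intro conjI, simp, rule exI[of _ 3], intro conjI allI impI)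
  fix X :: real and h :: "nat \<Rightarrow> int" and B :: "real set"
  assume X: "X \<ge> 3" and B [measurable]: "B \<in> sets lebesgue"
  define Q where "Q = Suc (nat \<lfloor>2 * X\<rfloor>)"
  define G where "G b = (LINT \<alpha>:unit_box k | (\<Pi>\<^sub>M j \<in> {1..<k}. lborel).
      weyl_sum k (\<alpha>(k := b)) X ^ s * e2pi (- (\<Sum>j = 1..k. (\<alpha>(k := b)) j * real_of_int (h j))))" for b
  define K where "K = 4 ^ s * X powr (- 1) * ln X ^ s"
  have "K \<ge> 0" using X by (simp add: K_def)
  \<comment> \<open>With \<open>p\<close> and \<open>q\<close> as (s+1)-th roots of the moments, the
    bound for fixed b takes the shape \<open>p b ^ s * q b\<close> required by Hoelder's inequality
    in b.\<close>
  define p where "p b = enn2real (box_moment (Suc s) k b (2 * X)) powr (1 / (real s + 1))" for b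
  define q where "q b = enn2real (box_moment (Suc s) k (real s * b) X) powr (1 / (real s + 1))" for b
  have pq: "p b \<ge> 0" "q b \<ge> 0" for b by (auto simp: p_def q_def)
  have root: "ennreal ((enn2real x powr (1 / (real s + 1))) ^ Suc s) = x" if "x < \<infinity>" for x
  proof -
    have "(enn2real x powr (1 / (real s + 1))) ^ Suc s = enn2real x"
      by (cases "enn2real x = 0") (simp_all add: powr_powr add_ac flip: powr_realpow del: power_Suc)
    then show ?thesis using that by simp
  qed
  have powr_s: "ennreal_powr x (real s / (real s + 1)) = ennreal ((enn2real x powr (1 / (real s + 1))) ^ s)"
    "ennreal_powr x (1 / (real s + 1)) = ennreal (enn2real x powr (1 / (real s + 1)))" if "x < \<infinity>" for x
    using that \<open>s \<ge> 1\<close>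
    by (cases "enn2real x = 0"; simp add: ennreal_powr_def powr_powr power_0_left flip: powr_realpow; fail)+
  have p_meas [measurable]: "p \<in> borel_measurable lebesgue" and q_meas [measurable]: "q \<in> borel_measurable lebesgue"
    unfolding p_def q_def by (rule measurable_completion, measurable)+
  have G_bound: "norm (G b) \<le> K * (p b ^ s * q b)" for b
  proof -
    define S where "S = (\<Sum>a<Q. norm (window_coeff Q (nat \<lfloor>X\<rfloor>) a))"
    have "S \<ge> 0" by (simp add: S_def sum_nonneg)
    have "S \<le> 4 * ln X" unfolding S_def using X Q_def by (rule sum_norm_window_coeff_le_ln)
    have "X \<ge> 0" using X by simp
    have "ennreal (real (Suc (nat \<lfloor>X\<rfloor>)) * norm (G b)) \<le> ennreal (S ^ s) * (ennreal (p b ^ s) * ennreal (q b))"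
      using inner_integral_bound[where h = "\<lambda>j. real_of_int (h j)" and b = b, OF assms \<open>X \<ge> 0\<close> Ints_of_int Q_def]
      unfolding powr_s[OF box_moment_finite] p_def[symmetric] q_def[symmetric] G_def[symmetric] S_def[symmetric] .
    also have "\<dots> = ennreal (S ^ s * (p b ^ s * q b))"
      using \<open>S \<ge> 0\<close> pq by (simp add: ennreal_mult)
    finally have "real (Suc (nat \<lfloor>X\<rfloor>)) * norm (G b) \<le> S ^ s * (p b ^ s * q b)"
      using \<open>S \<ge> 0\<close> pq by (subst (asm) ennreal_le_iff) auto
    \<comment> \<open>The number of shifts y is at least X, and this is the source of the saving
      1/X.\<close>
    moreover have "X * norm (G b) \<le> real (Suc (nat \<lfloor>X\<rfloor>)) * norm (G b)"
      using X by (intro mult_right_mono) (auto, linarith)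
    moreover have "S ^ s * (p b ^ s * q b) \<le> (4 * ln X) ^ s * (p b ^ s * q b)"
      using \<open>S \<ge> 0\<close> \<open>S \<le> 4 * ln X\<close> pq by (intro mult_right_mono power_mono) auto
    ultimately have "X * norm (G b) \<le> (4 * ln X) ^ s * (p b ^ s * q b)" by linarith
    then show ?thesis
      using X by (simp add: K_def powr_minus field_simps)
  qed
  have "ennreal (cmod (I_int k s B X h)) \<le> (\<integral>\<^sup>+b. ennreal (norm (indicator B b *\<^sub>R G b)) \<partial>lebesgue)"
  proof (cases "integrable lebesgue (\<lambda>b. indicator B b *\<^sub>R G b)")
    case True
    then show ?thesis
      unfolding I_int_def G_def set_lebesgue_integral_def[of lebesgue] by (rule integral_norm_bound_ennreal)
  next
    \<comment> \<open>The Bochner integral of a non-integrable function has the default value 0, so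
      the bound is trivial here.\<close>
    case False
    then have "I_int k s B X h = 0"
      unfolding I_int_def G_def set_lebesgue_integral_def[of lebesgue] by (rule not_integrable_integral_eq)
    then show ?thesis by simp
  qed
  \<comment> \<open>The indicator goes into both factors, so that each of the two resulting moments
    is an integral over B.\<close>
  also have "\<dots> \<le> (\<integral>\<^sup>+b. ennreal K * ennreal ((p b * indicator B b) ^ s * (q b * indicator B b)) \<partial>lebesgue)"
    using G_bound \<open>K \<ge> 0\<close> pq
    by (intro nn_integral_mono) (auto simp: indicator_def simp flip: ennreal_mult intro!: ennreal_leI)
  also have "\<dots> = ennreal K * (\<integral>\<^sup>+b. ennreal ((p b * indicator B b) ^ s * (q b * indicator B b)) \<partial>lebesgue)"
    by (rule nn_integral_cmult) measurable
  also have "\<dots> \<le> ennreal K * (ennreal_powr (\<integral>\<^sup>+b. ennreal ((p b * indicator B b) ^ Suc s) \<partial>lebesgue) (real s / (real s + 1))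
      * ennreal_powr (\<integral>\<^sup>+b. ennreal ((q b * indicator B b) ^ Suc s) \<partial>lebesgue) (1 / (real s + 1)))"
    using pq \<open>s \<ge> 1\<close> by (intro mult_left_mono nn_integral_Holder_power) auto
  also have "(\<integral>\<^sup>+b. ennreal ((p b * indicator B b) ^ Suc s) \<partial>lebesgue) = J_star (s + 1) k B (2 * X)"
    unfolding J_star_eq_box_moment p_def
    by (intro nn_integral_cong) (auto simp: indicator_def root[OF box_moment_finite] simp del: power_Suc)
  also have "(\<integral>\<^sup>+b. ennreal ((q b * indicator B b) ^ Suc s) \<partial>lebesgue) = (\<integral>\<^sup>+ b \<in> B. box_moment (s + 1) k (real s * b) X \<partial>lebesgue)"
    unfolding q_def
    by (intro nn_integral_cong) (auto simp: indicator_def root[OF box_moment_finite] simp del: power_Suc)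
  also have "ennreal K * (ennreal_powr (J_star (s + 1) k B (2 * X)) (real s / (real s + 1)) * ennreal_powr \<dots> (1 / (real s + 1)))
      \<le> ennreal K * (ennreal_powr (J_star (s + 1) k B (2 * X)) (real s / (real s + 1))
        * ennreal_powr (J_star (s + 1) k ((\<lambda>b. real s * b) ` B) X) (1 / (real s + 1)))"
  \<comment> \<open>The mean value over the dilated set is s times the integral over B, and s \<ge>
    1 allows the factor 1/s to be discarded.\<close>
  proof (intro mult_left_mono ennreal_powr_mono)
    have "1 * (\<integral>\<^sup>+ b \<in> B. box_moment (s + 1) k (real s * b) X \<partial>lebesgue)
      \<le> ennreal (real s) * (\<integral>\<^sup>+ b \<in> B. box_moment (s + 1) k (real s * b) X \<partial>lebesgue)"
      using \<open>s \<ge> 1\<close> by (intro mult_right_mono) auto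
    then show "(\<integral>\<^sup>+ b \<in> B. box_moment (s + 1) k (real s * b) X \<partial>lebesgue) \<le> J_star (s + 1) k ((\<lambda>b. real s * b) ` B) X"
      unfolding J_star_dilate[OF \<open>s \<ge> 1\<close> B] by simp
  qed auto
  finally show "ennreal (cmod (I_int k s B X h))
      \<le> ennreal (4 ^ s * X powr (- 1) * ln X ^ s)
        * ennreal_powr (J_star (s + 1) k B (2 * X)) (real s / (real s + 1))
        * ennreal_powr (J_star (s + 1) k ((\<lambda>b. real s * b) ` B) X) (1 / (real s + 1))"
    unfolding K_def mult.assoc .
qed simp

end
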